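(* Let $\Gamma$ be an $n$-vertex (simple) graph with matching number $\nu(\Gamma)=m$. Then \[ \mathrm{mis}(\Gamma) \leq \begin{cases} 3^m & \text{if } m \leq \frac{n}{3},\\ 2^{3m-n}\cdot 3^{n-2m} & \text{if } m > \frac{n}{3}. \end{cases} \] In the first case, equality holds if and only if each component of $\Gamma$ is a $K_3$ or an isolated vertex. In the second case, equality holds if and only if each component of $\Gamma$ is a $K_2$, $K_3$, $K_4$ or $D_6$.
   Context: $\mathrm{mis}(\Gamma)$ denotes the number of maximal (with respect to inclusion) independent sets of $\Gamma$. $\nu(\Gamma)$ is the maximum size of a matching in $\Gamma$. $D_6$ denotes the graph consisting of two vertex-disjoint triangles joined by a single edge. *)

theory Defs
  imports "Graph_Theory.Digraph_Isomorphism" "Graph_Theory.Kuratowski"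
begin

text \<open>
  A finite simple graph is a \<^term>\<open>G\<close> with \<^prop>\<open>graph G\<close>: finite, loop-free, without
  parallel arcs, and with symmetric arcs. An undirected edge is thus a pair of opposite arcs;
  \<open>edge_set\<close> identifies the two.
\<close>

definition edge_set :: "('a, 'b) pre_digraph \<Rightarrow> 'a set set" where
  "edge_set G = {{u, v} | u v. u \<rightarrow>\<^bsub>G\<^esub> v}"

definition independent_set :: "('a, 'b) pre_digraph \<Rightarrow> 'a set \<Rightarrow> bool" where
  "independent_set G S \<longleftrightarrow> S \<subseteq> verts G \<and> (\<forall>u\<in>S. \<forall>v\<in>S. \<not> u \<rightarrow>\<^bsub>G\<^esub> v)"

definition maximal_independent_set :: "('a, 'b) pre_digraph \<Rightarrow> 'a set \<Rightarrow> bool" where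
  "maximal_independent_set G S \<longleftrightarrow>
     independent_set G S \<and> (\<forall>T. independent_set G T \<and> S \<subseteq> T \<longrightarrow> T = S)"

definition mis :: "('a, 'b) pre_digraph \<Rightarrow> nat" where
  "mis G = card {S. maximal_independent_set G S}"

definition matching :: "('a, 'b) pre_digraph \<Rightarrow> 'a set set \<Rightarrow> bool" where
  "matching G M \<longleftrightarrow> M \<subseteq> edge_set G \<and> pairwise disjnt M"

definition matching_number :: "('a, 'b) pre_digraph \<Rightarrow> nat" where
  "matching_number G = Max (card ` {M. matching G M})"

text \<open>The components are the maximal connected (hence nonempty) subgraphs.\<close>

definition components :: "('a, 'b) pre_digraph \<Rightarrow> ('a, 'b) pre_digraph set" where
  "components G = {H. pre_digraph.max_subgraph G connected H}"

text \<open>The triangles 0, 1, 2 and 3, 4, 5, joined by the edge from 0 to 3.\<close>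

definition D6_half :: "nat rel" where
  "D6_half = {(0, 1), (0, 2), (1, 2), (3, 4), (3, 5), (4, 5), (0, 3)}"

definition D6 :: "(nat, nat \<times> nat) pre_digraph" where
  "D6 = with_proj \<lparr> pverts = {0..<6}, parcs = D6_half \<union> D6_half\<inverse> \<rparr>"

lemma graph_D6: "graph D6"
proof -
  have "pair_graph \<lparr> pverts = {0..<6}, parcs = D6_half \<union> D6_half\<inverse> \<rparr>"
    by unfold_locales (auto simp: D6_half_def symmetric_def sym_def)
  then show ?thesis
    unfolding D6_def by (rule pair_graph.pair_graphD_graph)
qed

end

theory Submission
  imports Defs
begin

text \<open>
  An edge \<open>uv\<close> sorts the maximal independent sets into those containing \<open>u\<close>, those
  containing \<open>v\<close> and the rest, which gives the bound \<open>3\<^sup>m\<close> by induction. For the other bound put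
  \<open>g(n, m) = (3/2)\<^sup>n (8/9)\<^sup>m = 2\<^bsup>3m - n\<^esup> 3\<^bsup>n - 2m\<^esup>\<close>. Deleting a vertex multiplies \<open>g\<close> by at most \<open>3/4\<close>,
  and deleting the closed neighbourhood of a vertex of degree \<open>d\<close> by at most
  \<open>(2/3)(3/4)\<^sup>d\<close>, because every edge meeting it meets one of the \<open>d\<close> neighbours. With
  \<open>mis(V) \<le> mis(V - v) + mis(V - N[v])\<close> and \<open>mis(V) \<le> (\<Sum>u\<in>N[v]. mis(V - N[u]))\<close> this yields a
  strict inequality at a vertex of degree at least 4, at a leaf whose neighbour has degree at
  least 2, and, after a short case analysis, in every other configuration except components
  \<open>K\<^sub>2\<close>, \<open>K\<^sub>3\<close>, \<open>K\<^sub>4\<close> and triangles attached through a single vertex. In the last case equality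
  propagates to two smaller graphs, and this forces the component \<open>D\<^sub>6\<close>.
\<close>

text \<open>The function g is multiplicative over disjoint unions and is fixed by giving K_2 the
  value 2 and K_3 the value 3; K_4 and D_6 then receive exactly their own counts 4 and 8. Deleting
  vertices does not preserve m > n/3, so mis \<le> g is proved for all graphs, with 3m - n possibly
  negative. The bound 3^m also holds for all graphs, and the case distinction merely selects the
  smaller of the two. Since 8/9 < 1, g grows when the matching number drops, so every deletion needs
  a proof that few matching edges are lost. Most of the slack comes from one source: an isolated
  vertex has weight 3/2 but only one maximal independent set, and a leaf outside a K_2 component is
  similarly wasteful. Degree 3 is the obstacle, because branching on such a vertex only gives 3/4 +
  9/32 = 33/32; a gain has to be found inside a branch. For a triangle attached through a single
  vertex the estimates add up to exactly 1, which is why the equality case has to be carried through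
  the induction.\<close>

locale adjacency =
  fixes adj :: "'a \<Rightarrow> 'a \<Rightarrow> bool"
  assumes adj_sym: "adj x y \<Longrightarrow> adj y x"
    and adj_irrefl: "\<not> adj x x"
begin

section \<open>Induced subgraphs, represented by vertex sets under one fixed adjacency
  relation\<close>

definition nbs :: "'a set \<Rightarrow> 'a \<Rightarrow> 'a set" where
  "nbs V v = {u \<in> V. adj v u}"

definition cnbs :: "'a set \<Rightarrow> 'a \<Rightarrow> 'a set" where
  "cnbs V v = insert v (nbs V v)"

definition is_mis :: "'a set \<Rightarrow> 'a set \<Rightarrow> bool" where
  "is_mis V S \<longleftrightarrow> S \<subseteq> V \<and> (\<forall>x\<in>S. \<forall>y\<in>S. \<not> adj x y) \<and> (\<forall>x\<in>V - S. \<exists>y\<in>S. adj x y)"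

definition num_mis :: "'a set \<Rightarrow> nat" where
  "num_mis V = card {S. is_mis V S}"

definition is_matching :: "'a set \<Rightarrow> 'a set set \<Rightarrow> bool" where
  "is_matching V M \<longleftrightarrow> (\<forall>e\<in>M. \<exists>x\<in>V. \<exists>y\<in>V. adj x y \<and> e = {x, y}) \<and> pairwise disjnt M"

definition nu :: "'a set \<Rightarrow> nat" where
  "nu V = Max (card ` {M. is_matching V M})"

text \<open>No edge of the graph induced on \<open>V\<close> leaves \<open>K\<close>, so
  \<open>K\<close> is a union of components, possibly empty. Connectedness is added separately by
  \<open>linked\<close>.\<close>

definition closed :: "'a set \<Rightarrow> 'a set \<Rightarrow> bool" where
  "closed V K \<longleftrightarrow> K \<subseteq> V \<and> (\<forall>x\<in>K. \<forall>y\<in>V - K. \<not> adj x y)"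

definition clique :: "'a set \<Rightarrow> bool" where
  "clique K \<longleftrightarrow> (\<forall>x\<in>K. \<forall>y\<in>K. x \<noteq> y \<longrightarrow> adj x y)"

lemma in_nbs [simp]: "u \<in> nbs V v \<longleftrightarrow> u \<in> V \<and> adj v u"
  by (simp add: nbs_def)

lemma in_cnbs [simp]: "u \<in> cnbs V v \<longleftrightarrow> u = v \<or> u \<in> V \<and> adj v u"
  by (simp add: cnbs_def)

lemma finite_nbs [simp]: "finite V \<Longrightarrow> finite (nbs V v)"
  by (simp add: nbs_def)

lemma finite_cnbs [simp]: "finite V \<Longrightarrow> finite (cnbs V v)"
  by (simp add: cnbs_def)

lemma nbs_Diff: "nbs (V - S) v = nbs V v - S"
  by auto

lemma cnbs_subset: "v \<in> V \<Longrightarrow> cnbs V v \<subseteq> V"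
  by auto

lemma card_cnbs: "finite V \<Longrightarrow> card (cnbs V v) = Suc (card (nbs V v))"
  by (simp add: cnbs_def adj_irrefl)

subsection \<open>Matchings\<close>

lemma is_matching_edge:
  assumes "is_matching V M" "e \<in> M"
  obtains x y where "x \<in> V" "y \<in> V" "adj x y" "e = {x, y}"
  using assms by (auto simp: is_matching_def)

lemma is_matching_disjoint:
  assumes "is_matching V M" "e \<in> M" "f \<in> M" "x \<in> e" "x \<in> f"
  shows "e = f"
proof (rule ccontr)
  assume "e \<noteq> f"
  then have "disjnt e f"
    using assms by (simp add: is_matching_def pairwise_def)
  then show False
    using assms(4,5) by (auto simp: disjnt_def)
qed

lemma is_matching_subset_Pow: "is_matching V M \<Longrightarrow> M \<subseteq> Pow V"
  by (auto elim!: is_matching_edge)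

lemma is_matching_empty: "is_matching V {}"
  by (simp add: is_matching_def)

lemma finite_is_matching: "finite V \<Longrightarrow> finite {M. is_matching V M}"
  by (rule finite_subset[of _ "Pow (Pow V)"]) (auto dest: is_matching_subset_Pow)

lemma is_matching_finite: "finite V \<Longrightarrow> is_matching V M \<Longrightarrow> finite M"
  by (meson finite_Pow_iff finite_subset is_matching_subset_Pow)

lemma nu_ge: "finite V \<Longrightarrow> is_matching V M \<Longrightarrow> card M \<le> nu V"
  unfolding nu_def by (rule Max_ge) (auto simp: finite_is_matching)

lemma nu_witness:
  assumes "finite V"
  obtains M where "is_matching V M" "card M = nu V"
proof -
  have "Max (card ` {M. is_matching V M}) \<in> card ` {M. is_matching V M}"
    using assms is_matching_empty by (intro Max_in) (auto simp: finite_is_matching)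
  then show thesis
    using that by (auto simp: nu_def)
qed

lemma is_matching_subset: "is_matching V M \<Longrightarrow> N \<subseteq> M \<Longrightarrow> is_matching V N"
  unfolding is_matching_def by (auto intro: pairwise_subset)

lemma is_matching_restrict:
  assumes "is_matching V M" "\<And>e. e \<in> M \<Longrightarrow> e \<subseteq> W"
  shows "is_matching W M"
  unfolding is_matching_def
proof (intro conjI ballI)
  fix e assume e: "e \<in> M"
  then obtain x y where "adj x y" "e = {x, y}"
    using assms(1) is_matching_edge by metis
  moreover from this have "x \<in> W" "y \<in> W"
    using assms(2)[OF e] by auto
  ultimately show "\<exists>x\<in>W. \<exists>y\<in>W. adj x y \<and> e = {x, y}"
    by auto
qed (use assms(1) in \<open>simp add: is_matching_def\<close>)

lemma is_matching_mono: "is_matching W M \<Longrightarrow> W \<subseteq> V \<Longrightarrow> is_matching V M"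
  using is_matching_restrict is_matching_subset_Pow by (metis Pow_iff subset_iff)

lemma nu_le_half:
  assumes "finite V"
  shows "2 * nu V \<le> card V"
proof -
  obtain M where M: "is_matching V M" "card M = nu V"
    using assms by (rule nu_witness)
  have "card (\<Union>M) = (\<Sum>e\<in>M. card e)"
    using M(1) assms by (intro card_Union_disjoint)
      (auto simp: is_matching_def intro: finite_subset)
  also have "\<dots> = (\<Sum>e\<in>M. 2)"
    using M(1) adj_irrefl by (intro sum.cong refl) (auto elim!: is_matching_edge simp: card_insert_if)
  finally have "card (\<Union>M) = 2 * nu V"
    using M(2) by simp
  moreover have "\<Union>M \<subseteq> V"
    using M(1) is_matching_subset_Pow by blast
  ultimately show ?thesis
    using assms card_mono by metis
qed

text \<open>Choosing for each matching edge that meets \<open>S\<close> one of its vertices in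
  \<open>T\<close> is injective because the edges are disjoint, so at most \<open>k\<close> edges
  are lost. The maximum matching \<open>M\<close> is a parameter so that the cover \<open>T\<close>
  may be adapted to it; the attached triangle relies on this freedom.\<close>

lemma nu_le_cover:
  assumes V: "finite V" and T: "finite T" "card T \<le> k"
    and M: "is_matching V M" "card M = nu V"
    and cov: "\<And>e. e \<in> M \<Longrightarrow> e \<inter> S \<noteq> {} \<Longrightarrow> e \<inter> T \<noteq> {}"
  shows "nu V \<le> nu (V - S) + k"
proof -
  define A where "A = {e \<in> M. e \<inter> S \<noteq> {}}"
  have fin: "finite M"
    using M(1) V is_matching_finite by blast
  have "\<forall>e\<in>A. \<exists>t. t \<in> T \<and> t \<in> e"
    using cov unfolding A_def by blast
  then obtain h where h: "\<And>e. e \<in> A \<Longrightarrow> h e \<in> T \<and> h e \<in> e"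
    by metis
  have AM: "A \<subseteq> M"
    by (auto simp: A_def)
  have "inj_on h A"
  proof (rule inj_onI)
    fix e f assume ef: "e \<in> A" "f \<in> A" "h e = h f"
    have "h e \<in> e" "h e \<in> f"
      using h[OF ef(1)] h[OF ef(2)] ef(3) by auto
    then show "e = f"
      using is_matching_disjoint[OF M(1)] AM ef(1,2) by blast
  qed
  moreover have "h ` A \<subseteq> T"
    using h by blast
  ultimately have "card A \<le> card T"
    using T(1) by (rule card_inj_on_le)
  have "is_matching (V - S) (M - A)"
  proof (rule is_matching_restrict[OF is_matching_subset[OF M(1)]])
    fix e assume e: "e \<in> M - A"
    then have "e \<subseteq> V"
      using is_matching_subset_Pow[OF M(1)] by blast
    moreover have "e \<inter> S = {}"
      using e by (simp add: A_def)
    ultimately show "e \<subseteq> V - S"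
      by blast
  qed simp
  then have "card (M - A) \<le> nu (V - S)"
    using V nu_ge by blast
  moreover have "card M = card A + card (M - A)"
    using fin AM by (simp add: card_Diff_subset card_mono finite_subset)
  ultimately show ?thesis
    using \<open>card A \<le> card T\<close> T(2) M(2) by linarith
qed

lemma nu_delete:
  assumes "finite V" "finite S"
  shows "nu V \<le> nu (V - S) + card S"
proof -
  obtain M where "is_matching V M" "card M = nu V"
    using assms(1) by (rule nu_witness)
  then show ?thesis
    using nu_le_cover[OF assms order_refl] by blast
qed

lemma nu_delete_cnbs:
  assumes "finite V"
  shows "nu V \<le> nu (V - cnbs V v) + card (nbs V v)"
proof -
  obtain M where M: "is_matching V M" "card M = nu V"
    using assms(1) by (rule nu_witness)
  show ?thesis
  proof (rule nu_le_cover[OF assms _ order_refl M])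
    fix e assume e: "e \<in> M" "e \<inter> cnbs V v \<noteq> {}"
    obtain x y where "x \<in> V" "y \<in> V" "adj x y" "e = {x, y}"
      using M(1) e(1) by (rule is_matching_edge)
    then show "e \<inter> nbs V v \<noteq> {}"
      using e(2) adj_sym by auto
  qed (use assms in simp)
qed

lemma nu_Un:
  assumes "finite V" "A \<subseteq> V" "B \<subseteq> V" "A \<inter> B = {}"
  shows "nu A + nu B \<le> nu V"
proof -
  have fin: "finite A" "finite B"
    using assms by (auto intro: finite_subset)
  obtain M where M: "is_matching A M" "card M = nu A"
    using fin(1) by (rule nu_witness)
  obtain N where N: "is_matching B N" "card N = nu B"
    using fin(2) by (rule nu_witness)
  have sub: "M \<subseteq> Pow A" "N \<subseteq> Pow B"
    using M N is_matching_subset_Pow by auto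
  have ne: "{} \<notin> M"
    using M(1) by (auto elim!: is_matching_edge)
  have "is_matching V (M \<union> N)"
    unfolding is_matching_def
  proof (intro conjI ballI)
    fix e assume "e \<in> M \<union> N"
    then show "\<exists>x\<in>V. \<exists>y\<in>V. adj x y \<and> e = {x, y}"
      using is_matching_mono[OF M(1) assms(2)] is_matching_mono[OF N(1) assms(3)]
      by (auto simp: is_matching_def)
  next
    show "pairwise disjnt (M \<union> N)"
      unfolding pairwise_def disjnt_def
    proof (intro ballI impI)
      fix e f assume ef: "e \<in> M \<union> N" "f \<in> M \<union> N" "e \<noteq> f"
      show "e \<inter> f = {}"
      proof (rule ccontr)
        assume "e \<inter> f \<noteq> {}"
        then obtain x where x: "x \<in> e" "x \<in> f"
          by auto
        have "g \<in> M \<longleftrightarrow> x \<in> A" if "g \<in> M \<union> N" "x \<in> g" for g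
          using that sub assms(4) by blast
        then have "e \<in> M \<longleftrightarrow> f \<in> M"
          using x ef(1,2) by blast
        then show False
          using ef x is_matching_disjoint[OF M(1), of e f x] is_matching_disjoint[OF N(1), of e f x]
          by auto
      qed
    qed
  qed
  moreover have "e = {}" if "e \<in> M" "e \<in> N" for e
    using that sub assms(4) by blast
  then have "M \<inter> N = {}"
    using ne by blast
  then have "card (M \<union> N) = nu A + nu B"
    using M N fin is_matching_finite by (metis card_Un_disjoint)
  ultimately show ?thesis
    using nu_ge[OF assms(1)] by metis
qed

lemma nu_edge:
  assumes "finite V" "x \<in> V" "y \<in> V" "adj x y"
  shows "1 \<le> nu V"
proof -
  have "is_matching V {{x, y}}"
    using assms by (auto simp: is_matching_def pairwise_def)
  then show ?thesis
    using nu_ge[OF assms(1), of "{{x, y}}"] by simp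
qed

lemma nu_delete_edge:
  assumes "finite V" "x \<in> V" "y \<in> V" "adj x y" "W \<subseteq> V - {x, y}"
  shows "nu W + 1 \<le> nu V"
proof -
  have "1 \<le> nu {x, y}"
    using assms(4) by (intro nu_edge[of _ x y]) auto
  then show ?thesis
    using nu_Un[OF assms(1), of W "{x, y}"] assms by fastforce
qed

lemma nu_closed:
  assumes "finite V" "closed V K"
  shows "nu V = nu K + nu (V - K)"
proof -
  obtain M where M: "is_matching V M" "card M = nu V"
    using assms(1) by (rule nu_witness)
  have fin: "finite M"
    using M(1) assms(1) is_matching_finite by blast
  have K: "K \<subseteq> V"
    using assms(2) by (simp add: closed_def)
  define A where "A = {e \<in> M. e \<subseteq> K}"
  have AM: "A \<subseteq> M"
    by (auto simp: A_def)
  have "is_matching K A"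
    by (rule is_matching_restrict[OF is_matching_subset[OF M(1)]]) (auto simp: A_def)
  then have "card A \<le> nu K"
    using nu_ge K assms(1) finite_subset by blast
  have "is_matching (V - K) (M - A)"
  proof (rule is_matching_restrict[OF is_matching_subset[OF M(1)]])
    fix e assume e: "e \<in> M - A"
    then obtain x y where "x \<in> V" "y \<in> V" "adj x y" "e = {x, y}"
      using is_matching_edge[OF M(1), of e] by blast
    then show "e \<subseteq> V - K"
      using e assms(2) adj_sym[of x y] unfolding A_def closed_def by blast
  qed simp
  then have "card (M - A) \<le> nu (V - K)"
    using nu_ge assms(1) by blast
  moreover have "card M = card A + card (M - A)"
    using fin AM by (simp add: card_Diff_subset card_mono finite_subset)
  ultimately have "nu V \<le> nu K + nu (V - K)"
    using \<open>card A \<le> nu K\<close> M(2) by linarith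
  then show ?thesis
    using nu_Un[OF assms(1) K, of "V - K"] by auto
qed

subsection \<open>Counting maximal independent sets\<close>

lemma finite_is_mis: "finite V \<Longrightarrow> finite {S. is_mis V S}"
  by (rule finite_subset[of _ "Pow V"]) (auto simp: is_mis_def)

lemma is_mis_extend:
  assumes "finite V" "I \<subseteq> V" "\<forall>x\<in>I. \<forall>y\<in>I. \<not> adj x y"
  obtains S where "is_mis V S" "I \<subseteq> S"
proof -
  define P where "P T \<longleftrightarrow> I \<subseteq> T \<and> T \<subseteq> V \<and> (\<forall>x\<in>T. \<forall>y\<in>T. \<not> adj x y)" for T
  have "finite {T. P T}"
    by (rule finite_subset[of _ "Pow V"]) (use assms(1) in \<open>auto simp: P_def\<close>)
  moreover have "I \<in> {T. P T}"
    using assms by (simp add: P_def)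
  ultimately obtain S where S: "S \<in> {T. P T}" "\<forall>T\<in>{T. P T}. S \<subseteq> T \<longrightarrow> T = S"
    using finite_has_maximal[of "{T. P T}"] by (metis empty_iff)
  have "\<exists>y\<in>S. adj x y" if "x \<in> V - S" for x
  proof (rule ccontr)
    assume "\<not> ?thesis"
    then have "P (insert x S)"
      using S(1) that adj_sym adj_irrefl unfolding P_def by blast
    then show False
      using S(2) that by blast
  qed
  then show thesis
    using S(1) by (intro that[of S]) (auto simp: is_mis_def P_def)
qed

lemma num_mis_empty [simp]: "num_mis {} = 1"
proof -
  have "{S. is_mis {} S} = {{}}"
    by (auto simp: is_mis_def)
  then show ?thesis
    by (simp add: num_mis_def)
qed

text \<open>Removing \<open>v\<close> loses no information, and what remains still dominates
  everything outside N[v], since \<open>v\<close> itself dominates nothing there.\<close>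

lemma card_mis_containing:
  assumes "finite V" "v \<in> V"
  shows "card {S. is_mis V S \<and> v \<in> S} \<le> num_mis (V - cnbs V v)"
  unfolding num_mis_def
proof (rule card_inj_on_le[where f = "\<lambda>S. S - {v}"])
  show "inj_on (\<lambda>S. S - {v}) {S. is_mis V S \<and> v \<in> S}"
    by (auto simp: inj_on_def)
  show "(\<lambda>S. S - {v}) ` {S. is_mis V S \<and> v \<in> S} \<subseteq> {S. is_mis (V - cnbs V v) S}"
  proof clarify
    fix S assume S: "is_mis V S" "v \<in> S"
    have "\<exists>y\<in>S - {v}. adj x y" if "x \<in> V - cnbs V v - (S - {v})" for x
    proof -
      have "x \<in> V - S"
        using that by auto
      then obtain y where "y \<in> S" "adj x y"
        using S(1) unfolding is_mis_def by blast
      then show ?thesis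
        using that adj_sym by auto
    qed
    then show "is_mis (V - cnbs V v) (S - {v})"
      using S unfolding is_mis_def by auto
  qed
qed (use assms finite_is_mis in simp)

lemma is_mis_delete: "is_mis V S \<Longrightarrow> S \<inter> X = {} \<Longrightarrow> is_mis (V - X) S"
  unfolding is_mis_def by blast

lemma card_mis_avoiding:
  assumes "finite V"
  shows "card {S. is_mis V S \<and> S \<inter> X = {}} \<le> num_mis (V - X)"
  unfolding num_mis_def
  using assms by (intro card_mono) (auto simp: finite_is_mis is_mis_delete)

lemma num_mis_le_delete:
  assumes "finite V" "v \<in> V"
  shows "num_mis V \<le> num_mis (V - {v}) + num_mis (V - cnbs V v)"
proof -
  have "{S. is_mis V S} = {S. is_mis V S \<and> S \<inter> {v} = {}} \<union> {S. is_mis V S \<and> v \<in> S}"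
    by auto
  then have "num_mis V \<le> card {S. is_mis V S \<and> S \<inter> {v} = {}} + card {S. is_mis V S \<and> v \<in> S}"
    unfolding num_mis_def by (metis card_Un_le)
  then show ?thesis
    using card_mis_containing[OF assms] card_mis_avoiding[OF assms(1), of "{v}"] by linarith
qed

text \<open>Every maximal independent set meets the closed neighbourhood of \<open>v\<close>.\<close>

lemma num_mis_le_cnbs:
  assumes "finite V" "v \<in> V"
  shows "num_mis V \<le> (\<Sum>u\<in>cnbs V v. num_mis (V - cnbs V u))"
proof -
  have "{S. is_mis V S} \<subseteq> (\<Union>u\<in>cnbs V v. {S. is_mis V S \<and> u \<in> S})"
  proof
    fix S assume "S \<in> {S. is_mis V S}"
    then have "v \<in> S \<or> (\<exists>y\<in>S. adj v y \<and> y \<in> V)"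
      using assms(2) unfolding is_mis_def by blast
    then show "S \<in> (\<Union>u\<in>cnbs V v. {S. is_mis V S \<and> u \<in> S})"
      using \<open>S \<in> {S. is_mis V S}\<close> by auto
  qed
  then have "num_mis V \<le> card (\<Union>u\<in>cnbs V v. {S. is_mis V S \<and> u \<in> S})"
    unfolding num_mis_def using assms(1) finite_is_mis[OF assms(1)]
    by (intro card_mono finite_UN_I) (auto intro: finite_subset)
  also have "\<dots> \<le> (\<Sum>u\<in>cnbs V v. card {S. is_mis V S \<and> u \<in> S})"
    using assms(1) by (intro card_UN_le) simp
  also have "\<dots> \<le> (\<Sum>u\<in>cnbs V v. num_mis (V - cnbs V u))"
    using assms card_mis_containing[OF assms(1)] cnbs_subset by (intro sum_mono) blast
  finally show ?thesis .
qed

text \<open>Without edges between \<open>K\<close> and its complement, maximal independent sets of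
  the two parts can be combined freely. This serves to show that the extremal graphs attain the
  bounds.\<close>

lemma num_mis_closed_ge:
  assumes "finite V" "closed V K"
  shows "num_mis K * num_mis (V - K) \<le> num_mis V"
proof -
  have K: "K \<subseteq> V" and no: "\<And>x y. x \<in> K \<Longrightarrow> y \<in> V - K \<Longrightarrow> \<not> adj x y \<and> \<not> adj y x"
    using assms(2) adj_sym unfolding closed_def by blast+
  have "card ({S. is_mis K S} \<times> {S. is_mis (V - K) S}) \<le> card {S. is_mis V S}"
  proof (rule card_inj_on_le[where f = "\<lambda>(S, T). S \<union> T"])
    show "inj_on (\<lambda>(S, T). S \<union> T) ({S. is_mis K S} \<times> {S. is_mis (V - K) S})"
    proof (rule inj_onI, clarify)
      fix S T S' T' assume "is_mis K S" "is_mis (V - K) T" "is_mis K S'" "is_mis (V - K) T'"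
        and eq: "S \<union> T = S' \<union> T'"
      then have "S \<subseteq> K" "S' \<subseteq> K" "T \<inter> K = {}" "T' \<inter> K = {}"
        by (auto simp: is_mis_def)
      then show "S = S' \<and> T = T'"
        using eq by blast
    qed
    show "(\<lambda>(S, T). S \<union> T) ` ({S. is_mis K S} \<times> {S. is_mis (V - K) S}) \<subseteq> {S. is_mis V S}"
    proof clarify
      fix S T assume S: "is_mis K S" and T: "is_mis (V - K) T"
      have "\<forall>x\<in>V - (S \<union> T). \<exists>y\<in>S \<union> T. adj x y"
        using S T unfolding is_mis_def by blast
      moreover have "\<forall>x\<in>S \<union> T. \<forall>y\<in>S \<union> T. \<not> adj x y"
        using S T no unfolding is_mis_def by blast
      moreover have "S \<union> T \<subseteq> V"
        using S T K unfolding is_mis_def by blast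
      ultimately show "is_mis V (S \<union> T)"
        by (simp add: is_mis_def)
    qed
  qed (use assms finite_is_mis in simp)
  then show ?thesis
    by (simp add: num_mis_def card_cartesian_product)
qed

lemma num_mis_clique:
  assumes "finite K" "clique K"
  shows "card K \<le> num_mis K"
  unfolding num_mis_def
proof (rule card_inj_on_le[where f = "\<lambda>x. {x}"])
  show "(\<lambda>x. {x}) ` K \<subseteq> {S. is_mis K S}"
    using assms(2) adj_irrefl by (auto simp: is_mis_def clique_def)
qed (use assms finite_is_mis in auto)

subsection \<open>Weights\<close>

text \<open>For \<open>n\<close> vertices and matching number \<open>m\<close> this is the bound
  \<open>2\<^bsup>3m - n\<^esup> 3\<^bsup>n - 2m\<^esup>\<close>, in a form that also makes sense for \<open>3m < n\<close>.\<close>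

definition wt :: "'a set \<Rightarrow> real" where
  "wt V = (3 / 2) ^ card V * (8 / 9) ^ nu V"

text \<open>The numerical part of the induction hypothesis. It passes to every subset of
  \<open>V\<close>, so strict local estimates can be applied again after a deletion.\<close>

definition sub_bounded :: "'a set \<Rightarrow> bool" where
  "sub_bounded V \<longleftrightarrow> (\<forall>W. W \<subset> V \<longrightarrow> real (num_mis W) \<le> wt W)"

lemma sub_boundedD: "sub_bounded V \<Longrightarrow> W \<subset> V \<Longrightarrow> real (num_mis W) \<le> wt W"
  by (simp add: sub_bounded_def)

lemma sub_bounded_subset: "sub_bounded V \<Longrightarrow> W \<subseteq> V \<Longrightarrow> sub_bounded W"
  unfolding sub_bounded_def by (meson order_less_le_trans)

lemma wt_pos: "0 < wt V"
  by (simp add: wt_def)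

text \<open>Each deleted vertex contributes 2/3 and each lost matching edge 9/8. The matching number
  enters with base 8/9 < 1, so an upper bound \<open>k\<close> on its drop suffices.\<close>

lemma wt_delete:
  assumes "finite V" "S \<subseteq> V" "nu V \<le> nu (V - S) + k"
  shows "wt (V - S) \<le> (2 / 3) ^ card S * (9 / 8) ^ k * wt V"
proof -
  have "card V = card S + card (V - S)"
    using assms(1,2) by (simp add: card_Diff_subset card_mono finite_subset)
  then have n: "(3 / 2) ^ card (V - S) = (2 / 3) ^ card S * (3 / 2 :: real) ^ card V"
    by (simp add: power_add flip: power_mult_distrib mult.assoc)
  have "(8 / 9 :: real) ^ (nu (V - S) + k) \<le> (8 / 9) ^ nu V"
    using assms(3) by (intro power_decreasing) auto
  then have "(9 / 8) ^ k * (8 / 9 :: real) ^ (nu (V - S) + k) \<le> (9 / 8) ^ k * (8 / 9) ^ nu V"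
    by (intro mult_left_mono) auto
  moreover have "(9 / 8) ^ k * (8 / 9 :: real) ^ (nu (V - S) + k) = (8 / 9) ^ nu (V - S)"
    by (simp add: power_add mult.left_commute flip: power_mult_distrib)
  ultimately have m: "(8 / 9 :: real) ^ nu (V - S) \<le> (9 / 8) ^ k * (8 / 9) ^ nu V"
    by simp
  have "wt (V - S) = (2 / 3) ^ card S * (3 / 2) ^ card V * (8 / 9) ^ nu (V - S)"
    by (simp add: wt_def n)
  also have "\<dots> \<le> (2 / 3) ^ card S * (3 / 2) ^ card V * ((9 / 8) ^ k * (8 / 9) ^ nu V)"
    using m by (intro mult_left_mono) auto
  finally show ?thesis
    by (simp add: wt_def mult_ac)
qed

lemma wt_delete_cnbs:
  assumes "finite V" "v \<in> V" "d \<le> card (nbs V v)"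
  shows "wt (V - cnbs V v) \<le> 2 / 3 * (3 / 4) ^ d * wt V"
proof -
  let ?k = "card (nbs V v)"
  have "wt (V - cnbs V v) \<le> (2 / 3) ^ card (cnbs V v) * (9 / 8) ^ ?k * wt V"
    using assms by (intro wt_delete nu_delete_cnbs cnbs_subset)
  also have "(2 / 3) ^ card (cnbs V v) * (9 / 8 :: real) ^ ?k = 2 / 3 * (3 / 4) ^ ?k"
    using assms(1) by (simp add: card_cnbs flip: power_mult_distrib)
  also have "\<dots> * wt V \<le> 2 / 3 * (3 / 4) ^ d * wt V"
    using assms(3) wt_pos[of V] by (intro mult_right_mono mult_left_mono power_decreasing) auto
  finally show ?thesis .
qed

lemma wt_delete_vertex:
  assumes "finite V" "v \<in> V"
  shows "wt (V - {v}) \<le> 3 / 4 * wt V"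
  using wt_delete[of V "{v}" 1] nu_delete[of V "{v}"] assms by simp

text \<open>At most half of the vertices of \<open>K\<close>, rounded down, are lost as matching
  edges. The factor is exactly 1/2, 1/3, 1/4 for 2, 3, 4 vertices, and 1/6 for 5 vertices.\<close>

lemma wt_delete_closed:
  assumes "finite V" "closed V K"
  shows "wt (V - K) \<le> (2 / 3) ^ card K * (9 / 8) ^ (card K div 2) * wt V"
proof (rule wt_delete[OF assms(1)])
  show K: "K \<subseteq> V"
    using assms(2) by (simp add: closed_def)
  have "nu K \<le> card K div 2"
    using nu_le_half[of K] K assms(1) finite_subset by fastforce
  then show "nu V \<le> nu (V - K) + card K div 2"
    using nu_closed[OF assms] by simp
qed

lemma num_mis_delete_cnbs:
  assumes "finite V" "sub_bounded V" "v \<in> V" "d \<le> card (nbs V v)"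
  shows "real (num_mis (V - cnbs V v)) \<le> 2 / 3 * (3 / 4) ^ d * wt V"
  using wt_delete_cnbs[OF assms(1,3,4)] sub_boundedD[OF assms(2), of "V - cnbs V v"] assms(3)
  by fastforce

lemma num_mis_delete_vertex:
  assumes "finite V" "sub_bounded V" "v \<in> V"
  shows "real (num_mis (V - {v})) \<le> 3 / 4 * wt V"
  using wt_delete_vertex[OF assms(1,3)] sub_boundedD[OF assms(2), of "V - {v}"] assms(3)
  by fastforce

lemma card_nbs_ge:
  assumes "finite V" "A \<subseteq> nbs V v"
  shows "card A \<le> card (nbs V v)"
  using assms by (simp add: card_mono)

subsection \<open>Local configurations that force strict inequality\<close>

text \<open>An isolated vertex gives the factor 2/3. A leaf whose neighbour has degree at least 2
  gives 1/2 + 3/8 = 7/8 by branching over N[v] = {v, u}. Both cases share one statement because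
  after a deletion often only an upper bound on the neighbourhood is known; the last hypothesis
  excludes a K_2 component, which is extremal.\<close>

lemma strict_leaf:
  assumes "finite V" "sub_bounded V" "v \<in> V" "nbs V v \<subseteq> {u}"
    and "u \<in> nbs V v \<Longrightarrow> \<exists>z\<in>V. adj u z \<and> z \<noteq> v"
  shows "real (num_mis V) \<le> 7 / 8 * wt V"
proof (cases "u \<in> nbs V v")
  case False
  then have "cnbs V v = {v}"
    using assms(4) by (auto simp: cnbs_def)
  then have "num_mis V \<le> num_mis (V - cnbs V v)"
    using num_mis_le_cnbs[OF assms(1,3)] by simp
  then show ?thesis
    using num_mis_delete_cnbs[OF assms(1-3), of 0] wt_pos[of V] by simp
next
  case True
  then obtain z where z: "z \<in> V" "adj u z" "z \<noteq> v"
    using assms(5) by blast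
  have u: "u \<in> V" "adj v u" "u \<noteq> v"
    using True adj_irrefl by auto
  have "cnbs V v = {v, u}"
    using True assms(4) by (auto simp: cnbs_def)
  then have "num_mis V \<le> num_mis (V - cnbs V v) + num_mis (V - cnbs V u)"
    using num_mis_le_cnbs[OF assms(1,3)] u(3) by simp
  moreover have "card {u} \<le> card (nbs V v)"
    using assms(1) True by (intro card_nbs_ge) auto
  then have "real (num_mis (V - cnbs V v)) \<le> 1 / 2 * wt V"
    using num_mis_delete_cnbs[OF assms(1-3), of 1] by simp
  moreover have "card {v, z} \<le> card (nbs V u)"
    using assms(1,3) z u adj_sym by (intro card_nbs_ge) auto
  then have "real (num_mis (V - cnbs V u)) \<le> 3 / 8 * wt V"
    using num_mis_delete_cnbs[OF assms(1,2) u(1), of 2] z(3) by (simp add: power2_eq_square)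
  ultimately show ?thesis
    by linarith
qed

text \<open>The two branches contribute 3/4 and (2/3)(3/4)^4 = 27/128.\<close>

lemma strict_degree_4:
  assumes "finite V" "sub_bounded V" "v \<in> V" "4 \<le> card (nbs V v)"
  shows "real (num_mis V) \<le> 123 / 128 * wt V"
  using num_mis_le_delete[OF assms(1,3)] num_mis_delete_vertex[OF assms(1-3)]
    num_mis_delete_cnbs[OF assms] by (simp add: power4_eq_xxxx)

text \<open>Deleting \<open>p\<close> turns \<open>w\<close> into a leaf at \<open>q\<close>, and
  \<open>z\<close> keeps this leaf from forming a K_2 component. The total is (3/4)(7/8) +
  (2/3)(3/4)^3 = 21/32 + 9/32.\<close>

lemma strict_degree_2_3:
  assumes "finite V" "sub_bounded V" "w \<in> V" "nbs V w = {p, q}" "p \<noteq> q" "3 \<le> card (nbs V p)"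
    and "z \<in> V" "adj q z" "z \<noteq> w" "z \<noteq> p"
  shows "real (num_mis V) \<le> 15 / 16 * wt V"
proof -
  have p: "p \<in> V" "p \<noteq> w"
    using assms(4) adj_irrefl by (auto simp: set_eq_iff)
  have "real (num_mis (V - {p})) \<le> 7 / 8 * wt (V - {p})"
  proof (rule strict_leaf)
    show "sub_bounded (V - {p})"
      using assms(2) by (rule sub_bounded_subset) auto
    show "nbs (V - {p}) w \<subseteq> {q}"
      using assms(4) by (auto simp: nbs_Diff)
  qed (use assms p in auto)
  moreover have "wt (V - {p}) \<le> 3 / 4 * wt V"
    using assms(1) p(1) by (rule wt_delete_vertex)
  moreover have "real (num_mis (V - cnbs V p)) \<le> 2 / 3 * (3 / 4) ^ 3 * wt V"
    using assms(1,2) p(1) assms(6) by (rule num_mis_delete_cnbs)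
  moreover have "num_mis V \<le> num_mis (V - {p}) + num_mis (V - cnbs V p)"
    using assms(1) p(1) by (rule num_mis_le_delete)
  ultimately show ?thesis
    by (simp add: power3_eq_cube)
qed

text \<open>A gain of 1/16 after deleting a vertex of degree 3 is enough: (3/4)(15/16) + 9/32 =
  63/64.\<close>

lemma strict_delete_vertex:
  assumes "finite V" "sub_bounded V" "v \<in> V" "3 \<le> card (nbs V v)"
    and "real (num_mis (V - {v})) \<le> 15 / 16 * wt (V - {v})"
  shows "real (num_mis V) \<le> 63 / 64 * wt V"
  using num_mis_le_delete[OF assms(1,3)] wt_delete_vertex[OF assms(1,3)] assms(5)
    num_mis_delete_cnbs[OF assms(1-4)] by (simp add: power3_eq_cube)

lemma card_3_cases:
  assumes "card A = 3" "a \<in> A" "b \<in> A" "a \<noteq> b"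
  obtains c where "A = {a, b, c}" "c \<noteq> a" "c \<noteq> b"
proof -
  have fin: "finite A"
    using assms(1) card.infinite by fastforce
  have "card (A - {a, b}) = 1"
    using assms fin by (subst card_Diff_subset) auto
  then obtain c where "A - {a, b} = {c}"
    using card_1_singletonE by blast
  then have "A = {a, b, c}" "c \<noteq> a" "c \<noteq> b"
    using assms(2,3) by auto
  then show thesis
    using that by blast
qed

text \<open>The path from \<open>v\<close> over \<open>w\<close> to \<open>p\<close> leaves N[v], so
  the cubic component is not K_4. Deleting \<open>v\<close> leaves \<open>w\<close> with degree 2
  while \<open>p\<close>, not adjacent to \<open>v\<close>, keeps degree 3. This is the
  configuration of \<open>strict_degree_2_3\<close> unless the third neighbour \<open>q\<close> of
  \<open>w\<close> has no neighbours besides \<open>v\<close>, \<open>w\<close> and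
  \<open>p\<close>.\<close>

lemma strict_cubic:
  assumes "finite V" "sub_bounded V" "v \<in> V" "card (nbs V v) = 3"
    and cubic: "\<And>x y. x \<in> V \<Longrightarrow> y \<in> V \<Longrightarrow> adj x y \<Longrightarrow> card (nbs V x) = 3 \<Longrightarrow> card (nbs V y) = 3"
    and w: "w \<in> nbs V v" and p: "p \<in> nbs V w" "p \<notin> cnbs V v"
  shows "real (num_mis V) \<le> 63 / 64 * wt V"
proof -
  have V: "w \<in> V" "p \<in> V" and a: "adj v w" "adj w v" "adj w p" "adj p w"
    using w p(1) adj_sym by auto
  have ne: "v \<noteq> w" "p \<noteq> w" "p \<noteq> v" "\<not> adj v p" "\<not> adj p v"
    using a p(2) V adj_irrefl adj_sym by auto
  have dw: "card (nbs V w) = 3"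
    using cubic[of v w] assms(3,4) V a by simp
  have dp: "card (nbs V p) = 3"
    using cubic[of w p] dw V a by simp
  obtain q where q: "nbs V w = {v, p, q}" "q \<noteq> v" "q \<noteq> p"
    using card_3_cases[OF dw, of v p] assms(3) V a ne by auto
  then have qV: "q \<in> V" "adj w q" "adj q w"
    using adj_sym by (auto simp: set_eq_iff)
  have dq: "card (nbs V q) = 3"
    using cubic[of w q] dw V qV by simp
  show ?thesis
  proof (cases "\<exists>z\<in>V - {v}. adj q z \<and> z \<noteq> w \<and> z \<noteq> p")
    case True
    then obtain z where z: "z \<in> V - {v}" "adj q z" "z \<noteq> w" "z \<noteq> p"
      by blast
    show ?thesis
    proof (rule strict_delete_vertex[OF assms(1-3)])
      show "real (num_mis (V - {v})) \<le> 15 / 16 * wt (V - {v})"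
      proof (rule strict_degree_2_3)
        show "sub_bounded (V - {v})"
          using assms(2) by (rule sub_bounded_subset) auto
        show "nbs (V - {v}) w = {p, q}"
          using q ne by (auto simp: nbs_Diff)
        have "nbs (V - {v}) p = nbs V p"
          using ne by auto
        then show "3 \<le> card (nbs (V - {v}) p)"
          using dp by simp
        show "z \<in> V - {v}" "adj q z" "z \<noteq> w" "z \<noteq> p"
          using z by auto
      qed (use assms(1) V(1) ne(1) q(3) in auto)
    qed (use assms(4) in simp)
  next
    case False
    then have "nbs V q \<subseteq> {v, w, p}"
      using qV by auto
    then have Nq: "nbs V q = {v, w, p}"
      using dq ne by (intro card_subset_eq) auto
    then have qa: "adj q v" "adj v q" "adj q p"
      using adj_sym by (auto simp: set_eq_iff)
    have "q \<noteq> w"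
      using qV adj_irrefl by auto
    \<comment> \<open>Now \<open>q\<close> is adjacent to \<open>v\<close>, and the roles of
      \<open>v\<close> and \<open>w\<close> are exchanged: deleting \<open>w\<close> leaves
      \<open>v\<close> with the neighbours \<open>x\<close> and \<open>q\<close>, where
      \<open>x\<close> keeps degree 3 and \<open>q\<close> still has the neighbour
      \<open>p\<close>.\<close>
    obtain x where x: "nbs V v = {w, q, x}" "x \<noteq> w" "x \<noteq> q"
      using card_3_cases[OF assms(4), of w q] V qV qa a \<open>q \<noteq> w\<close> by auto
    then have xV: "x \<in> V" "adj v x"
      by (auto simp: set_eq_iff)
    have "x \<noteq> p" "x \<noteq> v"
      using xV ne adj_irrefl by auto
    have "\<not> adj w x"
      using q(1) xV(1) x \<open>x \<noteq> p\<close> \<open>x \<noteq> v\<close> by (auto simp: set_eq_iff)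
    show ?thesis
    proof (rule strict_delete_vertex[OF assms(1,2) V(1)])
      show "real (num_mis (V - {w})) \<le> 15 / 16 * wt (V - {w})"
      proof (rule strict_degree_2_3)
        show "sub_bounded (V - {w})"
          using assms(2) by (rule sub_bounded_subset) auto
        show "nbs (V - {w}) v = {x, q}"
          using x \<open>q \<noteq> w\<close> by (auto simp: nbs_Diff)
        have "nbs (V - {w}) x = nbs V x"
          using \<open>\<not> adj w x\<close> adj_sym by auto
        then show "3 \<le> card (nbs (V - {w}) x)"
          using cubic[of v x] assms(3,4) xV by simp
        show "p \<in> V - {w}" "adj q p" "p \<noteq> v" "p \<noteq> x"
          using V ne qa \<open>x \<noteq> p\<close> by auto
      qed (use assms(1,3) ne(1) x(3) in auto)
    qed (use dw in simp)
  qed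
qed

section \<open>Components that are cycles\<close>

lemma card_2_cases:
  assumes "card A = 2" "a \<in> A"
  obtains b where "A = {a, b}" "b \<noteq> a"
  using assms by (auto simp: card_2_iff)

lemma num_mis_le_sum_3:
  assumes "finite V" "v \<in> V" "nbs V v = {a, b}" "a \<noteq> b"
  shows "num_mis V \<le> num_mis (V - cnbs V v) + num_mis (V - cnbs V a) + num_mis (V - cnbs V b)"
proof -
  have "v \<notin> {a, b}"
    using assms(3) adj_irrefl by (auto simp: set_eq_iff)
  then show ?thesis
    using num_mis_le_cnbs[OF assms(1,2)] assms(3,4) by (simp add: cnbs_def)
qed

text \<open>Three branches at a vertex of degree 2 cost 3/8 each, which is 9/8 in total. A wasteful
  leaf or isolated vertex in each branch improves this to 3 * (7/8)(3/8) = 63/64.\<close>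

lemma strict_leaf_cnbs:
  assumes "finite V" "sub_bounded V" "v \<in> V" "card (nbs V v) = 2"
    and "x \<in> V - cnbs V v" "nbs (V - cnbs V v) x \<subseteq> {u}"
    and "u \<in> nbs (V - cnbs V v) x \<Longrightarrow> \<exists>z\<in>V - cnbs V v. adj u z \<and> z \<noteq> x"
  shows "real (num_mis (V - cnbs V v)) \<le> 21 / 64 * wt V"
proof -
  have "real (num_mis (V - cnbs V v)) \<le> 7 / 8 * wt (V - cnbs V v)"
  proof (rule strict_leaf[OF _ _ assms(5,6)])
    show "sub_bounded (V - cnbs V v)"
      using assms(2) by (rule sub_bounded_subset) auto
  qed (use assms(1) in simp, rule assms(7))
  then show ?thesis
    using wt_delete_cnbs[OF assms(1,3), of 2] assms(4) by (simp add: power2_eq_square)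
qed

text \<open>On a cycle of length 4 or at least 6, deleting any of N[v], N[a], N[b] leaves an
  isolated vertex or a leaf outside a K_2 component. Length 5 is exceptional, because there the
  deletion leaves an isolated edge, and that is an extremal block.\<close>

lemma strict_cycle:
  assumes "finite V" "sub_bounded V" and reg: "\<And>x. x \<in> V \<Longrightarrow> card (nbs V x) = 2"
    and v: "v \<in> V" "nbs V v = {a, b}" "a \<noteq> b" "\<not> adj a b"
  shows "real (num_mis V) \<le> 63 / 64 * wt V"
proof -
  have ab: "a \<in> V" "b \<in> V" "adj v a" "adj a v" "adj v b" "adj b v" "\<not> adj b a"
    using v adj_sym by (auto simp: set_eq_iff)
  have ne: "v \<noteq> a" "v \<noteq> b"
    using ab adj_irrefl by auto
  obtain c where c: "nbs V a = {v, c}" "c \<noteq> v"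
    using card_2_cases[OF reg, of a v] v(1) ab by auto
  obtain d where d: "nbs V b = {v, d}" "d \<noteq> v"
    using card_2_cases[OF reg, of b v] v(1) ab by auto
  have cd: "c \<in> V" "adj a c" "adj c a" "d \<in> V" "adj b d" "adj d b"
    using c d adj_sym by (auto simp: set_eq_iff)
  have ne': "c \<noteq> a" "c \<noteq> b" "d \<noteq> a" "d \<noteq> b"
    using cd ab v(4) adj_irrefl by auto
  have cn: "cnbs V v = {v, a, b}" "cnbs V a = {a, v, c}" "cnbs V b = {b, v, d}"
    using v c d by (auto simp: cnbs_def)
  note [simp] = adj_irrefl
  show ?thesis
  proof (cases "c \<noteq> d \<and> adj c d")
    case False
    obtain e where e: "nbs V c = {a, e}" "e \<noteq> a"
      using card_2_cases[OF reg, of c a] cd ab by auto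
    obtain f where f: "nbs V d = {b, f}" "f \<noteq> b"
      using card_2_cases[OF reg, of d b] cd ab by auto
    have V1: "real (num_mis (V - cnbs V v)) \<le> 21 / 64 * wt V"
    proof (rule strict_leaf_cnbs[OF assms(1,2) v(1) reg[OF v(1)]])
      show "c \<in> V - cnbs V v" "nbs (V - cnbs V v) c \<subseteq> {e}"
        using cd ne' c e by (auto simp: cn nbs_Diff)
      assume "e \<in> nbs (V - cnbs V v) c"
      then have eV: "e \<in> V" "e \<noteq> v" "e \<noteq> b" "adj c e" "adj e c"
        using adj_sym by (auto simp: cn)
      obtain z where z: "nbs V e = {c, z}" "z \<noteq> c"
        using card_2_cases[OF reg[OF eV(1)], of c] eV cd by auto
      have zV: "z \<in> V" "adj e z" "adj z e"
        using z adj_sym by (auto simp: set_eq_iff)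
      have "z \<noteq> v"
        using zV v(2) eV e(2) by (metis in_nbs insertE singletonD)
      moreover have "z \<noteq> a"
        using zV c(1) eV(1,2,4) by (metis adj_irrefl in_nbs insertE singletonD)
      moreover have "z \<noteq> b"
        using zV d(1) eV False by (metis adj_irrefl in_nbs insertE singletonD)
      ultimately show "\<exists>z\<in>V - cnbs V v. adj e z \<and> z \<noteq> c"
        using zV z(2) by (auto simp: cn)
    qed
    have V2: "real (num_mis (V - cnbs V a)) \<le> 21 / 64 * wt V"
    proof (rule strict_leaf_cnbs[OF assms(1,2) ab(1) reg[OF ab(1)]])
      show "b \<in> V - cnbs V a" "nbs (V - cnbs V a) b \<subseteq> {d}"
        using v ab ne' d by (auto simp: cn nbs_Diff)
      assume "d \<in> nbs (V - cnbs V a) b"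
      then have "c \<noteq> d"
        by (auto simp: cn)
      have fV: "f \<in> V" "adj d f"
        using f by (auto simp: set_eq_iff)
      have "f \<noteq> a"
        using fV c(1) d(2) \<open>c \<noteq> d\<close> cd(4) adj_sym by (metis in_nbs insertE singletonD)
      moreover have "f \<noteq> v"
        using fV v(2) cd(4) ne' adj_sym by (metis in_nbs insertE singletonD)
      moreover have "f \<noteq> c"
        using fV False \<open>c \<noteq> d\<close> adj_sym by blast
      ultimately show "\<exists>z\<in>V - cnbs V a. adj d z \<and> z \<noteq> b"
        using fV f(2) by (auto simp: cn)
    qed
    have V3: "real (num_mis (V - cnbs V b)) \<le> 21 / 64 * wt V"
    proof (rule strict_leaf_cnbs[OF assms(1,2) ab(2) reg[OF ab(2)]])
      show "a \<in> V - cnbs V b" "nbs (V - cnbs V b) a \<subseteq> {c}"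
        using v ab ne' c by (auto simp: cn nbs_Diff)
      assume "c \<in> nbs (V - cnbs V b) a"
      then have "c \<noteq> d"
        by (auto simp: cn)
      have eV: "e \<in> V" "adj c e"
        using e by (auto simp: set_eq_iff)
      have "e \<noteq> b"
        using eV d(1) c(2) \<open>c \<noteq> d\<close> cd(1) adj_sym by (metis in_nbs insertE singletonD)
      moreover have "e \<noteq> v"
        using eV v(2) cd(1) ne' adj_sym by (metis in_nbs insertE singletonD)
      moreover have "e \<noteq> d"
        using eV False \<open>c \<noteq> d\<close> adj_sym by blast
      ultimately show "\<exists>z\<in>V - cnbs V b. adj c z \<and> z \<noteq> a"
        using eV e(2) by (auto simp: cn)
    qed
    show ?thesis
      using num_mis_le_sum_3[OF assms(1) v(1-3)] V1 V2 V3 by linarith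
  next
    case True
    \<comment> \<open>The component is a 5-cycle, which has only 5 maximal independent sets.\<close>
    then have acd: "c \<noteq> d" "adj c d" "adj d c"
      using adj_sym by auto
    have Nc: "nbs V c = {a, d}"
      using card_2_cases[OF reg[OF cd(1)], of a] ab cd acd ne' by (metis in_nbs insertE singletonD)
    have Nd: "nbs V d = {b, c}"
      using card_2_cases[OF reg[OF cd(4)], of b] ab cd acd ne' by (metis in_nbs insertE singletonD)
    define K where "K = {v, a, b, c, d}"
    define R where "R = num_mis (V - K)"
    have N: "nbs V x \<subseteq> K" if "x \<in> K" for x
      using that v c d Nc Nd unfolding K_def by auto
    have K: "closed V K"
      unfolding closed_def
    proof (intro conjI ballI)
      show "K \<subseteq> V"
        using v(1) ab cd by (auto simp: K_def)
      fix x y assume "x \<in> K" "y \<in> V - K"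
      then show "\<not> adj x y"
        using N[of x] by auto
    qed
    have "card K = 5"
      using v(3) ne ne' c(2) d(2) acd(1) by (auto simp: K_def)
    \<comment> \<open>The factor is (2/3)^5 (9/8)^2 = 1/6, so the bound \<open>5 * R\<close> proved
      below yields 5/6, which is less than 63/64.\<close>
    then have "wt (V - K) \<le> 1 / 6 * wt V"
      using wt_delete_closed[OF assms(1) K] by (simp add: power_divide)
    moreover have "V - K \<subset> V"
      using v(1) by (auto simp: K_def)
    then have "real R \<le> wt (V - K)"
      using sub_boundedD[OF assms(2)] by (simp add: R_def)
    moreover have edge: "num_mis (V - (K - {x, y})) \<le> 2 * R"
      if "x \<in> K" "y \<in> K" "adj x y" for x y
    proof -
      let ?W = "V - (K - {x, y})"
      have xy: "x \<in> V" "y \<in> V" "x \<noteq> y" "adj y x"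
        using that K adj_sym by (auto simp: closed_def)
      have "nbs ?W x = {y}" "nbs ?W y = {x}"
        using N[OF that(1)] N[OF that(2)] that xy by (auto simp: nbs_Diff)
      then have "cnbs ?W x = {x, y}" "cnbs ?W y = {x, y}"
        by (auto simp: cnbs_def)
      moreover have "?W - {x, y} = V - K"
        using that by auto
      ultimately show ?thesis
        using num_mis_le_cnbs[of ?W x] assms(1) xy by (simp add: R_def)
    qed
    have n1: "num_mis (V - cnbs V v) \<le> 2 * R"
    proof -
      have "V - cnbs V v = V - (K - {c, d})"
        using ne' c(2) d(2) by (auto simp: cn K_def)
      then show ?thesis
        using edge[of c d] acd by (simp add: K_def)
    qed
    \<comment> \<open>Without \<open>v\<close> the cycle becomes the path a, c, d, b. Branching at
      its end \<open>a\<close> leaves the edge \<open>bd\<close>, which counts twice, or the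
      isolated vertex \<open>b\<close>, which counts once.\<close>
    have n2: "num_mis (V - {v}) \<le> 3 * R"
    proof -
      let ?W = "V - {v}"
      have Na: "cnbs ?W a = {a, c}"
        using c by (auto simp: cnbs_def nbs_Diff)
      have Nc': "cnbs ?W c = {c, a, d}"
        using Nc ne d(2) by (auto simp: cnbs_def nbs_Diff)
      have "num_mis ?W \<le> num_mis (?W - {a, c}) + num_mis (?W - {c, a, d})"
        using num_mis_le_cnbs[of ?W a] assms(1) ab(1) ne ne'(1) by (simp add: Na Nc')
      moreover have "?W - {a, c} = V - (K - {b, d})"
        using ne ne' v(3) d(2) acd(1) by (auto simp: K_def)
      then have "num_mis (?W - {a, c}) \<le> 2 * R"
        using edge[of b d] cd by (simp add: K_def)
      moreover have "num_mis (?W - {c, a, d}) \<le> R"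
      proof -
        let ?U = "?W - {c, a, d}"
        have "nbs ?U b = {}"
          using d by (auto simp: nbs_Diff)
        then have "cnbs ?U b = {b}"
          by (simp add: cnbs_def)
        moreover have "?U - {b} = V - K"
          by (auto simp: K_def)
        moreover have "b \<in> ?U"
          using ab ne ne' v(3) by auto
        ultimately show ?thesis
          using num_mis_le_cnbs[of ?U b] assms(1) by (simp add: R_def)
      qed
      ultimately show ?thesis
        by linarith
    qed
    have "num_mis V \<le> 5 * R"
      using num_mis_le_delete[OF assms(1) v(1)] n1 n2 by linarith
    ultimately show ?thesis
      using wt_pos[of V] by linarith
  qed
qed

subsection \<open>Decompositions into components\<close>

text \<open>No partition is mentioned: for the predicates used, every block is
  \<open>linked\<close>, and blocks that are closed and linked are automatically equal or
  disjoint.\<close>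

definition decomposes :: "('a set \<Rightarrow> bool) \<Rightarrow> 'a set \<Rightarrow> bool" where
  "decomposes F V \<longleftrightarrow> (\<forall>v\<in>V. \<exists>K. v \<in> K \<and> closed V K \<and> F K)"

text \<open>Connectedness in terms of cuts. This is the counterpart of \<open>closed\<close>: a
  nonempty set that is both is a component.\<close>

definition linked :: "'a set \<Rightarrow> bool" where
  "linked K \<longleftrightarrow> (\<forall>X\<subseteq>K. X \<noteq> {} \<longrightarrow> X \<noteq> K \<longrightarrow> (\<exists>x\<in>X. \<exists>y\<in>K - X. adj x y))"

text \<open>The graph D_6 described by its vertices inside the ambient graph, with \<open>px\<close>
  as joining edge. The isomorphism with \<open>D6\<close> is established only at the
  transfer.\<close>

definition double_triangle :: "'a set \<Rightarrow> bool" where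
  "double_triangle K \<longleftrightarrow> (\<exists>p w q x s t. distinct [p, w, q, x, s, t] \<and> K = {p, w, q, x, s, t} \<and>
     clique {p, w, q} \<and> clique {x, s, t} \<and> adj p x \<and>
     (\<forall>a\<in>{p, w, q}. \<forall>b\<in>{x, s, t}. adj a b \<longrightarrow> a = p \<and> b = x))"

definition small_block :: "'a set \<Rightarrow> bool" where
  "small_block K \<longleftrightarrow> clique K \<and> (card K = 1 \<or> card K = 3)"

definition block :: "'a set \<Rightarrow> bool" where
  "block K \<longleftrightarrow> clique K \<and> (card K = 2 \<or> card K = 3 \<or> card K = 4) \<or> double_triangle K"

lemma double_triangleE:
  assumes "double_triangle K"
  obtains p w q x s t where "distinct [p, w, q, x, s, t]" "K = {p, w, q, x, s, t}"
    "clique {p, w, q}" "clique {x, s, t}" "adj p x"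
    "\<forall>a\<in>{p, w, q}. \<forall>b\<in>{x, s, t}. adj a b \<longrightarrow> a = p \<and> b = x"
  using assms unfolding double_triangle_def by (elim exE conjE) (rule that)

lemma linked_clique: "clique K \<Longrightarrow> linked K"
  unfolding clique_def linked_def by (metis Diff_iff subset_antisym subset_iff ex_in_conv)

text \<open>A cut that splits \<open>A\<close> or \<open>B\<close> is crossed by an edge inside that
  part; any other cut separates \<open>A\<close> from \<open>B\<close> and is crossed by
  \<open>xy\<close>.\<close>

lemma linked_Un:
  assumes "linked A" "linked B" "x \<in> A" "y \<in> B" "adj x y"
  shows "linked (A \<union> B)"
  unfolding linked_def
proof (intro allI impI)
  fix X assume X: "X \<subseteq> A \<union> B" "X \<noteq> {}" "X \<noteq> A \<union> B"
  show "\<exists>x\<in>X. \<exists>y\<in>A \<union> B - X. adj x y"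
  proof (cases "(X \<inter> A = {} \<or> X \<inter> A = A) \<and> (X \<inter> B = {} \<or> X \<inter> B = B)")
    case True
    then have "A \<subseteq> X \<and> B \<inter> X = {} \<or> B \<subseteq> X \<and> A \<inter> X = {}"
      using X by blast
    then show ?thesis
      using assms(3-5) adj_sym by blast
  next
    case False
    then consider "X \<inter> A \<noteq> {}" "X \<inter> A \<noteq> A" | "X \<inter> B \<noteq> {}" "X \<inter> B \<noteq> B"
      by blast
    then show ?thesis
    proof cases
      case 1
      then obtain x y where "x \<in> X \<inter> A" "y \<in> A - X \<inter> A" "adj x y"
        using assms(1) unfolding linked_def by (meson inf_le2)
      then show ?thesis by blast
    next
      case 2
      then obtain x y where "x \<in> X \<inter> B" "y \<in> B - X \<inter> B" "adj x y"
        using assms(2) unfolding linked_def by (meson inf_le2)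
      then show ?thesis by blast
    qed
  qed
qed

lemma linked_double_triangle:
  assumes "double_triangle K"
  shows "linked K"
proof -
  obtain p w q x s t where K: "K = {p, w, q, x, s, t}"
    and c: "clique {p, w, q}" "clique {x, s, t}" and px: "adj p x"
    using assms by (elim double_triangleE)
  have "linked ({p, w, q} \<union> {x, s, t})"
    by (rule linked_Un[OF linked_clique[OF c(1)] linked_clique[OF c(2)] _ _ px]) auto
  then show ?thesis
    by (simp add: K insert_commute)
qed

lemma linked_block: "block K \<Longrightarrow> linked K"
  using linked_clique linked_double_triangle by (auto simp: block_def)

lemma linked_small_block: "small_block K \<Longrightarrow> linked K"
  using linked_clique by (simp add: small_block_def)

lemma closed_Diff:
  assumes "closed V K" "closed (V - K) L"
  shows "closed V L"
  using assms adj_sym unfolding closed_def by blast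

lemma closed_nbs: "closed V K \<Longrightarrow> x \<in> K \<Longrightarrow> nbs V x = nbs K x"
  unfolding closed_def nbs_def by blast

lemma nbs_clique:
  assumes "clique K" "x \<in> K"
  shows "nbs K x = K - {x}"
proof -
  have "adj x y \<longleftrightarrow> y \<noteq> x" if "y \<in> K" for y
    using assms that adj_irrefl[of x] unfolding clique_def by metis
  then show ?thesis
    by auto
qed

lemma closedI: "K \<subseteq> V \<Longrightarrow> (\<And>x. x \<in> K \<Longrightarrow> nbs V x \<subseteq> K) \<Longrightarrow> closed V K"
  unfolding closed_def nbs_def by blast

lemma decomposes_insert:
  assumes "closed V K" "F K" "decomposes F (V - K)"
  shows "decomposes F V"
  unfolding decomposes_def
proof
  fix v assume "v \<in> V"
  show "\<exists>K. v \<in> K \<and> closed V K \<and> F K"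
  proof (cases "v \<in> K")
    case False
    then obtain L where "v \<in> L" "closed (V - K) L" "F L"
      using assms(3) \<open>v \<in> V\<close> unfolding decomposes_def by blast
    then show ?thesis
      using closed_Diff assms(1) by blast
  qed (use assms in blast)
qed

text \<open>A linked block containing a vertex outside \<open>K\<close> cannot meet
  \<open>K\<close>, as an edge of the block would then leave the closed set. Hence it survives the
  deletion intact.\<close>

lemma decomposes_delete:
  assumes "closed V K" "decomposes F V" "\<And>L. F L \<Longrightarrow> linked L"
  shows "decomposes F (V - K)"
  unfolding decomposes_def
proof
  fix v assume v: "v \<in> V - K"
  then obtain L where L: "v \<in> L" "closed V L" "F L"
    using assms(2) unfolding decomposes_def by blast
  have "L \<inter> K = {}"
  proof (rule ccontr)
    assume "L \<inter> K \<noteq> {}"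
    then obtain x y where "x \<in> L \<inter> K" "y \<in> L - L \<inter> K" "adj x y"
      using assms(3)[OF L(3)] L(1) v unfolding linked_def by (metis Diff_iff Int_iff inf_le1)
    then show False
      using assms(1) L(2) unfolding closed_def by blast
  qed
  then have "closed (V - K) L"
    using L(2) unfolding closed_def by blast
  then show "\<exists>L. v \<in> L \<and> closed (V - K) L \<and> F L"
    using L by blast
qed

lemma decomposes_induct [consumes 2, case_names linked empty insert]:
  assumes "finite V" "decomposes F V" "\<And>K. F K \<Longrightarrow> linked K"
    and "P {}"
    and "\<And>V K. finite V \<Longrightarrow> closed V K \<Longrightarrow> F K \<Longrightarrow> P (V - K) \<Longrightarrow> P V"
  shows "P V"
  using assms(1,2)
proof (induction V rule: finite_psubset_induct)
  case (psubset V)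
  show ?case
  proof (cases "V = {}")
    case False
    then obtain v K where K: "v \<in> V" "v \<in> K" "closed V K" "F K"
      using psubset.prems unfolding decomposes_def by blast
    then have "V - K \<subset> V"
      by blast
    then have "P (V - K)"
      using psubset.IH decomposes_delete[OF K(3) psubset.prems assms(3)] by blast
    then show ?thesis
      using assms(5) psubset.hyps K by blast
  qed (use assms(4) in simp)
qed

section \<open>Parameters of the extremal blocks\<close>

text \<open>A vertex \<open>x\<close> of D_6 of degree 2 lies in a triangle with \<open>r\<close>
  and \<open>h\<close>, where \<open>h\<close> carries the joining edge to \<open>z\<close>.
  Deleting \<open>x\<close> makes \<open>r\<close> a leaf at \<open>h\<close>, which
  \<open>strict_leaf\<close> can exploit.\<close>

lemma double_triangle_vertex:
  assumes "double_triangle K" "x \<in> K"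
  shows "3 \<le> card (nbs K x) \<or>
    (\<exists>r h z. r \<in> K \<and> h \<in> K \<and> z \<in> K \<and> nbs K r = {x, h} \<and> h \<noteq> x \<and> adj h z \<and> z \<noteq> r \<and> z \<noteq> x)"
proof -
  \<comment> \<open>Stated for arbitrary names so that it also applies with the two triangles
    interchanged.\<close>
  have main: "3 \<le> card (nbs L y) \<or>
      (\<exists>r h z. r \<in> L \<and> h \<in> L \<and> z \<in> L \<and> nbs L r = {y, h} \<and> h \<noteq> y \<and> adj h z \<and> z \<noteq> r \<and> z \<noteq> y)"
    if d: "distinct [a, b, c, d, e, f]" and L: "L = {a, b, c, d, e, f}"
      and abc: "clique {a, b, c}" and ad: "adj a d"
      and no: "\<forall>u\<in>{a, b, c}. \<forall>v\<in>{d, e, f}. adj u v \<longrightarrow> u = a \<and> v = d" and y: "y \<in> {a, b, c}"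
    for L a b c d e f y
  proof -
    have t: "adj a b" "adj b a" "adj a c" "adj c a" "adj b c" "adj c b"
      using abc d by (auto simp: clique_def)
    have ne: "b \<noteq> a" "c \<noteq> a" "b \<noteq> c" "d \<noteq> a" "d \<noteq> b" "d \<noteq> c"
      using d by auto
    have n: "\<not> adj b d" "\<not> adj b e" "\<not> adj b f" "\<not> adj c d" "\<not> adj c e" "\<not> adj c f"
      using no ne(1,2) by simp_all
    consider "y = a" | "y = b" | "y = c"
      using y by blast
    then show ?thesis
    proof cases
      case 1
      have "card {b, c, d} \<le> card (nbs L a)"
        using t ad by (intro card_nbs_ge) (auto simp: L)
      then show ?thesis
        using 1 d by simp
    next
      case 2
      have "nbs L c = {b, a}"
        unfolding nbs_def L using t n adj_irrefl[of c] by blast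
      then show ?thesis
        using 2 ne ad by (intro disjI2 exI[of _ c] exI[of _ a] exI[of _ d]) (simp add: L)
    next
      case 3
      have "nbs L b = {c, a}"
        unfolding nbs_def L using t n adj_irrefl[of b] by blast
      then show ?thesis
        using 3 ne ad by (intro disjI2 exI[of _ b] exI[of _ a] exI[of _ d]) (simp add: L)
    qed
  qed
  show ?thesis
    using assms(1)
  proof (rule double_triangleE)
    fix p w q r s t
    assume d: "distinct [p, w, q, r, s, t]" and K: "K = {p, w, q, r, s, t}"
      and c: "clique {p, w, q}" "clique {r, s, t}" and pr: "adj p r"
      and no: "\<forall>a\<in>{p, w, q}. \<forall>b\<in>{r, s, t}. adj a b \<longrightarrow> a = p \<and> b = r"
    show ?thesis
    proof (cases "x \<in> {p, w, q}")
      case True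
      then show ?thesis
        by (rule main[OF d K c(1) pr no])
    next
      case False
      then have x: "x \<in> {r, s, t}"
        using assms(2) K by simp
      have d': "distinct [r, s, t, p, w, q]"
        using d by auto
      have K': "K = {r, s, t, p, w, q}"
        using K by (simp add: insert_commute)
      have no': "\<forall>u\<in>{r, s, t}. \<forall>v\<in>{p, w, q}. adj u v \<longrightarrow> u = r \<and> v = p"
        using no adj_sym by blast
      show ?thesis
        by (rule main[OF d' K' c(2) adj_sym[OF pr] no' x])
    qed
  qed
qed

text \<open>One vertex is taken from each triangle; of the nine pairs only the adjacent pair
  \<open>p\<close>, \<open>x\<close> is lost.\<close>

lemma num_mis_double_triangle:
  assumes "double_triangle K"
  shows "8 \<le> num_mis K"
proof -
  obtain p w q x s t where d: "distinct [p, w, q, x, s, t]" and K: "K = {p, w, q, x, s, t}"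
     and c: "clique {p, w, q}" "clique {x, s, t}" and px: "adj p x"
     and no: "\<forall>a\<in>{p, w, q}. \<forall>b\<in>{x, s, t}. adj a b \<longrightarrow> a = p \<and> b = x"
    using assms by (rule double_triangleE)
  define C where "C = {{w, x}, {w, s}, {w, t}, {q, x}, {q, s}, {q, t}, {p, s}, {p, t}}"
  have m: "is_mis K {a, b}" if "a \<in> {p, w, q}" "b \<in> {x, s, t}" "a \<noteq> p \<or> b \<noteq> x" for a b
  proof -
    have nadj: "\<not> adj a b" "\<not> adj b a"
      using that no adj_sym by blast+
    have dom: "\<forall>y\<in>{p, w, q} - {a}. adj y a" "\<forall>y\<in>{x, s, t} - {b}. adj y b"
      using c that unfolding clique_def by blast+
    have sub: "{a, b} \<subseteq> K" "K - {a, b} \<subseteq> ({p, w, q} - {a}) \<union> ({x, s, t} - {b})"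
      using that K by auto
    have "\<exists>z\<in>{a, b}. adj y z" if "y \<in> K - {a, b}" for y
      using subsetD[OF sub(2) that] dom by blast
    then show ?thesis
      using sub(1) nadj adj_irrefl by (simp add: is_mis_def)
  qed
  have ne: "p \<noteq> w" "p \<noteq> q" "x \<noteq> s" "x \<noteq> t"
    using d by auto
  have "C \<subseteq> {S. is_mis K S}"
    unfolding C_def using ne by (intro insert_subsetI empty_subsetI CollectI m) auto
  then have "card C \<le> num_mis K"
    unfolding num_mis_def using K by (intro card_mono finite_is_mis) auto
  moreover have "card C = 8"
    using d unfolding C_def by (auto simp: card_insert_if doubleton_eq_iff)
  ultimately show ?thesis
    by simp
qed

text \<open>The edges \<open>wq\<close>, \<open>st\<close> and \<open>px\<close> form a perfect
  matching.\<close>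

lemma nu_double_triangle:
  assumes "double_triangle K"
  shows "3 \<le> nu K"
proof -
  obtain p w q x s t where d: "distinct [p, w, q, x, s, t]" and K: "K = {p, w, q, x, s, t}"
     and c: "clique {p, w, q}" "clique {x, s, t}" and px: "adj p x"
    using assms by (elim double_triangleE)
  have a: "adj w q" "adj s t"
    using c d by (auto simp: clique_def)
  have "nu {} + 1 \<le> nu {w, q}"
    using a by (intro nu_delete_edge[of _ w q]) auto
  also have "nu {w, q} + 1 \<le> nu {w, q, s, t}"
    using a d by (intro nu_delete_edge[of _ s t]) auto
  also have "nu {w, q, s, t} + 1 \<le> nu K"
    using px d by (intro nu_delete_edge[of _ p x]) (auto simp: K)
  finally show ?thesis
    by simp
qed

lemma nu_clique:
  assumes "finite K" "clique K"
  shows "card K div 2 \<le> nu K"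
  using assms
proof (induction "card K" arbitrary: K rule: less_induct)
  case less
  show ?case
  proof (cases "card K < 2")
    case False
    then obtain A where "A \<subseteq> K" "card A = 2"
      by (meson not_less obtain_subset_with_card_n)
    then obtain x y where xy: "x \<in> K" "y \<in> K" "x \<noteq> y"
      by (auto simp: card_2_iff)
    have c: "card K = card (K - {x, y}) + 2"
      using xy less.prems(1) False by (simp add: card_Diff_subset)
    have "clique (K - {x, y})"
      using less.prems(2) by (simp add: clique_def)
    then have "card (K - {x, y}) div 2 \<le> nu (K - {x, y})"
      using less.hyps[of "K - {x, y}"] less.prems(1) c by simp
    moreover have "nu (K - {x, y}) + 1 \<le> nu K"
      using less.prems xy by (intro nu_delete_edge[of _ x y]) (auto simp: clique_def)
    ultimately show ?thesis
      using c by simp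
  qed simp
qed

subsection \<open>The bound by powers of three\<close>

text \<open>The last class is counted in \<open>V\<close> rather than bounded by
  \<open>num_mis (V - {u, v})\<close>. Comparing the two numbers later shows that every maximal
  independent set of V - {u, v} dominates \<open>u\<close> and \<open>v\<close>.\<close>

lemma num_mis_le_edge:
  assumes "finite V" "u \<in> V" "v \<in> V"
  shows "num_mis V \<le> num_mis (V - cnbs V u) + num_mis (V - cnbs V v)
    + card {S. is_mis V S \<and> S \<inter> {u, v} = {}}"
proof -
  have "{S. is_mis V S} = {S. is_mis V S \<and> u \<in> S} \<union> {S. is_mis V S \<and> v \<in> S}
      \<union> {S. is_mis V S \<and> S \<inter> {u, v} = {}}" (is "_ = ?A \<union> ?B \<union> ?C")
    by auto
  then have "num_mis V = card (?A \<union> ?B \<union> ?C)"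
    unfolding num_mis_def by (rule arg_cong)
  also have "\<dots> \<le> card ?A + card ?B + card ?C"
    using card_Un_le[of "?A \<union> ?B" ?C] card_Un_le[of ?A ?B] by linarith
  finally show ?thesis
    using card_mis_containing[OF assms(1,2)] card_mis_containing[OF assms(1,3)] by linarith
qed

lemma nu_delete_isolated: "finite V \<Longrightarrow> nbs V v = {} \<Longrightarrow> nu V \<le> nu (V - {v})"
  using nu_delete_cnbs[of V v] by (simp add: cnbs_def)

lemma small_block_nbs:
  assumes "decomposes small_block V" "x \<in> V" "nbs V x \<noteq> {}"
  obtains y z where "nbs V x = {y, z}" "nbs V y = {x, z}" "y \<noteq> z"
proof -
  obtain K where K: "x \<in> K" "closed V K" "clique K" "card K = 1 \<or> card K = 3"
    using assms(1,2) unfolding decomposes_def small_block_def by blast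
  have N: "nbs V a = K - {a}" if "a \<in> K" for a
    using closed_nbs[OF K(2) that] nbs_clique[OF K(3) that] by simp
  have "card K \<noteq> 1"
    using N[OF K(1)] assms(3) K(1) by (metis card_1_singletonE Diff_cancel singletonD)
  then have c: "card K = 3"
    using K(4) by simp
  obtain y where y: "y \<in> K" "x \<noteq> y"
    using N[OF K(1)] assms(3) by blast
  obtain z where z: "K = {x, y, z}" "z \<noteq> x" "z \<noteq> y"
    using card_3_cases[OF c K(1) y] .
  have "nbs V x = {y, z}" "nbs V y = {x, z}"
    using N[OF K(1)] N[OF y(1)] z y(2) by auto
  then show thesis
    using that z(3) by blast
qed

text \<open>Each of the three classes is counted by a subset of \<open>R\<close>, whose matching
  number is at most \<open>k\<close>, one less than that of \<open>V\<close>. In the equality case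
  all three counts are 3^k, so \<open>R\<close> and both sets V - N[u] and V - N[v] have matching
  number \<open>k\<close> and consist of triangles and isolated vertices. These facts force
  \<open>uv\<close> into a triangle component.\<close>

theorem num_mis_le_3_power:
  assumes "finite V"
  shows "num_mis V \<le> 3 ^ nu V \<and> (num_mis V = 3 ^ nu V \<longrightarrow> decomposes small_block V)"
  using assms
proof (induction V rule: finite_psubset_induct)
  case (psubset V)
  show ?case
  proof (cases "\<exists>u\<in>V. \<exists>v\<in>V. adj u v")
    case False
    have "S = V" if "is_mis V S" for S
      using that False unfolding is_mis_def by blast
    then have "card {S. is_mis V S} \<le> card {V}"
      by (intro card_mono) auto
    then have "num_mis V \<le> 1"
      by (simp add: num_mis_def)
    then have "num_mis V \<le> 3 ^ nu V"
      by (meson order_trans one_le_numeral one_le_power)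
    moreover have "decomposes small_block V"
      unfolding decomposes_def
    proof
      fix v assume "v \<in> V"
      then have "closed V {v}" "small_block {v}"
        using False by (auto simp: closed_def small_block_def clique_def)
      then show "\<exists>K. v \<in> K \<and> closed V K \<and> small_block K"
        by blast
    qed
    ultimately show ?thesis
      by blast
  next
    case True
    then obtain u v where uv: "u \<in> V" "v \<in> V" "adj u v" "adj v u"
      using adj_sym by blast
    have "u \<noteq> v"
      using uv adj_irrefl by auto
    define R where "R = V - {u, v}"
    define C where "C = {S. is_mis V S \<and> S \<inter> {u, v} = {}}"
    have "1 \<le> nu V"
      using psubset.hyps uv(1-3) by (rule nu_edge)
    then obtain k where k: "nu V = Suc k"
      by (cases "nu V") auto
    have nuk: "nu W \<le> k" if "W \<subseteq> R" for W
      using nu_delete_edge[OF psubset.hyps uv(1-3), of W] that k by (simp add: R_def)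
    have pow: "num_mis W \<le> 3 ^ k \<and> (num_mis W = 3 ^ k \<longrightarrow> nu W = k \<and> decomposes small_block W)"
      if "W \<subseteq> R" for W
    proof -
      have "W \<subset> V"
        using that uv by (auto simp: R_def)
      then have W: "num_mis W \<le> 3 ^ nu W" "num_mis W = 3 ^ nu W \<longrightarrow> decomposes small_block W"
        using psubset.IH by blast+
      have p: "(3::nat) ^ nu W \<le> 3 ^ k" "(3::nat) ^ nu W = 3 ^ k \<longleftrightarrow> nu W = k"
        using nuk[OF that] by (simp_all add: power_increasing)
      have "num_mis W = 3 ^ nu W \<and> (3::nat) ^ nu W = 3 ^ k" if "num_mis W = 3 ^ k"
        using that W(1) p(1) by linarith
      then show ?thesis
        using W p by (metis order_trans)
    qed
    have sub: "V - cnbs V u \<subseteq> R" "V - cnbs V v \<subseteq> R"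
      using uv by (auto simp: R_def)
    have CR: "C \<subseteq> {S. is_mis R S}"
      by (auto simp: C_def R_def is_mis_delete)
    have finR: "finite R"
      using psubset.hyps by (simp add: R_def)
    then have finM: "finite {S. is_mis R S}"
      by (rule finite_is_mis)
    have cC: "card C \<le> num_mis R"
      unfolding num_mis_def using finM CR by (rule card_mono)
    have le: "num_mis V \<le> num_mis (V - cnbs V u) + num_mis (V - cnbs V v) + card C"
      unfolding C_def using psubset.hyps uv(1,2) by (rule num_mis_le_edge)
    have p3: "(3::nat) ^ nu V = 3 ^ k + 3 ^ k + 3 ^ k"
      by (simp add: k)
    have "decomposes small_block V" if eq: "num_mis V = 3 ^ nu V"
    proof -
      have e: "num_mis (V - cnbs V u) = 3 ^ k" "num_mis (V - cnbs V v) = 3 ^ k"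
        "card C = num_mis R" "num_mis R = 3 ^ k"
        using eq le cC pow[OF sub(1)] pow[OF sub(2)] pow[OF order_refl] p3 by linarith+
      have R: "nu R = k" "decomposes small_block R"
        using pow[of R] e by auto
      have "C = {S. is_mis R S}"
        using card_subset_eq[OF finM CR] e(3) by (simp add: num_mis_def)
      moreover obtain S where S: "is_mis R S"
        using is_mis_extend[of R "{}"] psubset.hyps by (auto simp: R_def)
      ultimately have "S \<in> C"
        by blast
      then have S: "is_mis V S" "S \<subseteq> R"
        using S by (simp_all add: C_def is_mis_def)
      \<comment> \<open>A maximal independent set of \<open>R\<close> is also maximal in
        \<open>V\<close>, so it contains a neighbour of \<open>u\<close> and one of
        \<open>v\<close>.\<close>
      have ex: "\<exists>x\<in>R. adj y x" if "y \<in> {u, v}" for y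
        using S that uv unfolding is_mis_def R_def by blast
      \<comment> \<open>Otherwise \<open>x\<close> lies in a triangle x, s, t of \<open>R\<close>.
        If \<open>y\<close> is adjacent to \<open>s\<close> or \<open>t\<close>, deleting N[y]
        removes an edge of \<open>R\<close> and costs matching number; if not, only the edge
        \<open>st\<close> of the triangle survives, which is not a small block.\<close>
      have isolated: "nbs R x = {}" if y: "y \<in> {u, v}" and x: "x \<in> R" "adj y x" for x y
      proof (rule ccontr)
        assume "nbs R x \<noteq> {}"
        then obtain s t where st: "nbs R x = {s, t}" "nbs R s = {x, t}" "s \<noteq> t"
          using small_block_nbs[OF R(2) x(1)] by blast
        let ?Y = "V - cnbs V y"
        have Y: "?Y \<subseteq> R" "nu ?Y = k" "decomposes small_block ?Y"
          using y sub pow[of ?Y] e by auto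
        have free: "\<not> adj y z" if "z \<in> nbs R x" for z
        proof
          assume "adj y z"
          then have "?Y \<subseteq> R - {x, z}"
            using Y(1) x that by (auto simp: R_def)
          then have "nu ?Y + 1 \<le> nu R"
            using that x(1) psubset.hyps by (intro nu_delete_edge[of _ x z]) (auto simp: R_def)
          then show False
            using Y(2) R(1) by simp
        qed
        have nst: "\<not> adj y s" "\<not> adj y t"
          using free st(1) by auto
        have "s \<in> R" "t \<in> R" "adj x s" "adj s t"
          using st by (auto simp: set_eq_iff)
        then have sY: "s \<in> ?Y"
          using nst y by (auto simp: R_def)
        have "nbs ?Y s \<subseteq> nbs R s"
          using Y(1) by auto
        then have "nbs ?Y s \<subseteq> {t}"
          using st(2) x by auto
        moreover have "t \<in> nbs ?Y s"
          using nst y \<open>t \<in> R\<close> \<open>adj s t\<close> by (auto simp: R_def)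
        ultimately have "nbs ?Y s = {t}"
          by blast
        then show False
          using small_block_nbs[OF Y(3) sY] by (metis doubleton_eq_iff insert_absorb2 insert_not_empty)
      qed
      \<comment> \<open>Two different neighbours \<open>a\<close>, \<open>b\<close> would be
        isolated in \<open>R\<close>, so \<open>ua\<close> and \<open>vb\<close> could be added to a
        maximum matching of \<open>R\<close>, giving k + 2 edges in \<open>V\<close>. Hence
        \<open>u\<close> and \<open>v\<close> have one common neighbour in \<open>R\<close> and no
        other.\<close>
      have same: "a = b" if ab: "a \<in> R" "adj u a" "b \<in> R" "adj v b" for a b
      proof (rule ccontr)
        assume "a \<noteq> b"
        have V: "a \<in> V" "b \<in> V" "a \<noteq> u" "a \<noteq> v" "b \<noteq> u" "b \<noteq> v"
          using ab by (auto simp: R_def)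
        have "nu (V - {u, a}) + 1 \<le> nu V"
          using psubset.hyps uv V ab(2) by (intro nu_delete_edge[of _ u a]) auto
        moreover have "nu (R - {a} - {b}) + 1 \<le> nu (V - {u, a})"
          using psubset.hyps uv V ab(4) \<open>a \<noteq> b\<close> \<open>u \<noteq> v\<close>
          by (intro nu_delete_edge[of _ v b]) (auto simp: R_def)
        moreover have "nbs R a = {}" "nbs R b = {}"
          using isolated ab by auto
        then have "nu R \<le> nu (R - {a})" "nu (R - {a}) \<le> nu (R - {a} - {b})"
          using finR by (auto intro!: nu_delete_isolated simp: nbs_Diff)
        ultimately show False
          using R(1) k by linarith
      qed
      obtain a where a: "a \<in> R" "adj u a"
        using ex by blast
      have av: "adj v a"
        using ex[of v] same[OF a] by auto
      have a0: "nbs R a = {}"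
        using isolated[of u] a by blast
      have "u \<noteq> a" "v \<noteq> a"
        using a(1) by (auto simp: R_def)
      have K: "closed V {u, v, a}"
      proof (rule closedI)
        show "{u, v, a} \<subseteq> V"
          using uv a by (auto simp: R_def)
        have inR: "z \<in> R \<or> z \<in> {u, v}" if "z \<in> V" for z
          using that by (auto simp: R_def)
        have "nbs V u \<subseteq> {u, v, a}"
          using inR same[OF _ _ a(1) av] by fastforce
        moreover have "nbs V v \<subseteq> {u, v, a}"
          using inR same[OF a] by fastforce
        moreover have "nbs V a \<subseteq> {u, v, a}"
          using inR a0 by fastforce
        ultimately show "\<And>x. x \<in> {u, v, a} \<Longrightarrow> nbs V x \<subseteq> {u, v, a}"
          by blast
      qed
      have K': "small_block {u, v, a}"
        using uv a av adj_sym \<open>u \<noteq> v\<close> \<open>u \<noteq> a\<close> \<open>v \<noteq> a\<close> by (auto simp: small_block_def clique_def)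
      have "closed R {a}"
        using a0 a(1) by (intro closedI) auto
      then have "decomposes small_block (R - {a})"
        using R(2) linked_small_block by (rule decomposes_delete)
      moreover have "R - {a} = V - {u, v, a}"
        by (auto simp: R_def)
      ultimately have "decomposes small_block (V - {u, v, a})"
        by simp
      with K K' show ?thesis
        by (rule decomposes_insert)
    qed
    moreover have "num_mis V \<le> 3 ^ nu V"
      using le cC pow[OF sub(1)] pow[OF sub(2)] pow[OF order_refl] p3 by linarith
    ultimately show ?thesis
      by blast
  qed
qed

lemma small_block_3_power_le:
  assumes "finite V" "decomposes small_block V"
  shows "3 ^ nu V \<le> num_mis V"
  using assms
proof (induction V rule: decomposes_induct)
  case (linked K)
  then show ?case
    by (rule linked_small_block)
next
  case empty
  have "nu {} = 0"
    using nu_le_half[of "{}"] by simp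
  then show ?case
    by simp
next
  case (insert V K)
  have fin: "finite K"
    using insert.hyps by (auto simp: closed_def intro: finite_subset)
  have "nu K = 0 \<and> 1 \<le> card K \<or> nu K = 1 \<and> card K = 3"
    using nu_le_half[OF fin] insert.hyps(3) unfolding small_block_def by linarith
  then have "3 ^ nu K \<le> card K"
    by auto
  also have "card K \<le> num_mis K"
    using fin insert.hyps(3) by (simp add: small_block_def num_mis_clique)
  finally have "3 ^ nu K * 3 ^ nu (V - K) \<le> num_mis K * num_mis (V - K)"
    using insert.IH by (intro mult_mono) auto
  then show ?case
    using nu_closed[OF insert.hyps(1,2)] num_mis_closed_ge[OF insert.hyps(1,2)]
    by (simp add: power_add)
qed

subsection \<open>The bound for large matching number\<close>

text \<open>The bound and the structure of the equality case go through the induction together,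
  because the attached triangle needs the blocks of a smaller graph.\<close>

definition wt_bounded :: "'a set \<Rightarrow> bool" where
  "wt_bounded V \<longleftrightarrow> real (num_mis V) \<le> wt V \<and> (real (num_mis V) = wt V \<longrightarrow> decomposes block V)"

lemma wt_bounded_strict:
  assumes "real (num_mis V) \<le> c * wt V" "c < 1"
  shows "wt_bounded V"
proof -
  have "c * wt V < wt V"
    using assms(2) wt_pos[of V] by simp
  then show ?thesis
    using assms(1) by (simp add: wt_bounded_def)
qed

text \<open>A clique component contributes the factor card K to the count, and deleting it divides
  the weight by at least card K. Equality for \<open>V\<close> therefore passes to V - K.\<close>

lemma wt_bounded_clique:
  assumes "finite V" and IH: "\<And>W. W \<subset> V \<Longrightarrow> wt_bounded W"
    and K: "closed V K" "clique K" "card K = 2 \<or> card K = 3 \<or> card K = 4"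
  shows "wt_bounded V"
proof -
  have "K \<noteq> {}"
    using K(3) by auto
  then obtain u where u: "u \<in> K"
    by blast
  have "K \<subseteq> V"
    using K(1) by (simp add: closed_def)
  then have R: "wt_bounded (V - K)"
    using u by (intro IH) auto
  have cn: "cnbs V x = K" if "x \<in> K" for x
    using closed_nbs[OF K(1) that] nbs_clique[OF K(2) that] that by (auto simp: cnbs_def)
  have "num_mis V \<le> (\<Sum>x\<in>K. num_mis (V - cnbs V x))"
    using num_mis_le_cnbs[of V u] cn[OF u] assms(1) u \<open>K \<subseteq> V\<close> by auto
  also have "\<dots> = card K * num_mis (V - K)"
    using cn by simp
  finally have le: "real (num_mis V) \<le> real (card K) * real (num_mis (V - K))"
    by (metis of_nat_le_iff of_nat_mult)
  have "wt (V - K) \<le> (2 / 3) ^ card K * (9 / 8) ^ (card K div 2) * wt V"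
    using assms(1) K(1) by (rule wt_delete_closed)
  then have w: "real (card K) * wt (V - K) \<le> wt V"
    using K(3) by (auto simp: power_divide)
  have b: "real (num_mis (V - K)) \<le> wt (V - K)"
    using R by (simp add: wt_bounded_def)
  then have "real (card K) * real (num_mis (V - K)) \<le> real (card K) * wt (V - K)"
    by (intro mult_left_mono) auto
  then have "real (num_mis V) \<le> wt V"
    using le w by linarith
  moreover have "decomposes block V" if "real (num_mis V) = wt V"
  proof -
    have "real (card K) * real (num_mis (V - K)) = real (card K) * wt (V - K)"
      using le w that \<open>real (card K) * real (num_mis (V - K)) \<le> _\<close> by linarith
    then have "real (num_mis (V - K)) = wt (V - K)"
      using K(3) by auto
    then have "decomposes block (V - K)"
      using R by (simp add: wt_bounded_def)
    moreover have "block K"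
      using K by (simp add: block_def)
    ultimately show ?thesis
      using K(1) decomposes_insert by blast
  qed
  ultimately show ?thesis
    by (simp add: wt_bounded_def)
qed

text \<open>Branching over N[w] gives 3/8 + 3/8 for \<open>w\<close> and \<open>q\<close>. The
  general estimate 9/32 at \<open>p\<close> would be too large; removing the triangle together with
  \<open>x\<close> costs only two matching edges, so the factor is (2/3)^4 (9/8)^2 = 1/4 and the sum
  is exactly 1. Equality must then hold both for W = V - T and for W - x, and this leaves only a
  triangle as the block of \<open>x\<close> in \<open>W\<close>.\<close>

lemma wt_bounded_pendant_triangle:
  assumes V: "finite V" and IH: "\<And>W. W \<subset> V \<Longrightarrow> wt_bounded W"
    and deg: "\<And>y. y \<in> V \<Longrightarrow> card (nbs V y) \<le> 3"
    and pwq: "p \<in> V" "w \<in> V" "q \<in> V" "w \<noteq> q"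
    and Nw: "nbs V w = {p, q}" and Nq: "nbs V q = {p, w}" and dp: "card (nbs V p) = 3"
  shows "wt_bounded V"
proof -
  have sb: "sub_bounded V"
    using IH by (simp add: sub_bounded_def wt_bounded_def)
  have a: "adj w p" "adj p w" "adj w q" "adj q w" "adj q p" "adj p q"
    using Nw Nq adj_sym by (auto simp: set_eq_iff)
  have ne: "p \<noteq> w" "p \<noteq> q"
    using a adj_irrefl by auto
  obtain x where Np: "nbs V p = {w, q, x}" and x: "x \<noteq> w" "x \<noteq> q"
    using card_3_cases[OF dp, of w q] pwq a by auto
  have xV: "x \<in> V" "adj p x" "adj x p"
    using Np adj_sym by (auto simp: set_eq_iff)
  have "x \<noteq> p"
    using xV adj_irrefl by auto
  define T where "T = {p, w, q}"
  have cn: "cnbs V w = T" "cnbs V q = T" "cnbs V p = insert x T"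
    using Nw Nq Np by (auto simp: cnbs_def T_def)
  have TV: "T \<subseteq> V" "x \<notin> T" "card T = 3" "finite T"
    using pwq x ne \<open>x \<noteq> p\<close> by (auto simp: T_def)
  have le: "num_mis V \<le> num_mis (V - T) + num_mis (V - insert x T) + num_mis (V - T)"
    using num_mis_le_sum_3[OF V pwq(2) Nw ne(2)] by (simp add: cn)
  have w1: "wt (V - T) \<le> 3 / 8 * wt V"
    using wt_delete_cnbs[OF V pwq(2), of 2] Nw ne by (simp add: cn power2_eq_square)
  have w2: "wt (V - insert x T) \<le> 1 / 4 * wt V"
  proof -
    obtain M where M: "is_matching V M" "card M = nu V"
      using V by (rule nu_witness)
    \<comment> \<open>An edge at \<open>w\<close> or \<open>q\<close> is \<open>wq\<close> or contains \<open>p\<close>; if \<open>wq\<close> is in \<open>M\<close>, then only \<open>px\<close> is left for \<open>p\<close>.\<close>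
    define C where "C = (if {w, q} \<in> M then {w, x} else {p, x})"
    have "nu V \<le> nu (V - insert x T) + 2"
    proof (rule nu_le_cover[OF V _ _ M])
      show "finite C" "card C \<le> 2"
        by (auto simp: C_def card_insert_if)
      fix e assume e: "e \<in> M" "e \<inter> insert x T \<noteq> {}"
      obtain g h where gh: "g \<in> V" "h \<in> V" "adj g h" "e = {g, h}"
        using M(1) e(1) by (rule is_matching_edge)
      then have "g \<in> insert x T \<or> h \<in> insert x T"
        using e(2) by blast
      moreover have "adj h g" "e = {h, g}"
        using gh adj_sym by auto
      ultimately obtain c d where cd: "c \<in> V" "d \<in> V" "adj c d" "e = {c, d}" "c \<in> insert x T"
        using gh by metis
      have ce: "c \<in> e" "d \<in> e"
        by (simp_all add: cd(4))
      have dN: "d \<in> nbs V c"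
        using cd(2,3) by simp
      have wq: "w \<in> e" if "{w, q} \<in> M" "q \<in> e"
        using is_matching_disjoint[OF M(1) e(1) that(1) that(2)] by simp
      have nwq: "\<not> (w \<in> e \<and> q \<in> e)" if "{w, q} \<notin> M"
      proof
        assume "w \<in> e \<and> q \<in> e"
        then have "(w = c \<or> w = d) \<and> (q = c \<or> q = d)"
          by (simp add: cd(4))
        then have "e = {w, q}"
          using pwq(4) by (auto simp: cd(4))
        then show False
          using e(1) that by simp
      qed
      have "c = x \<or> c = w \<and> (d = p \<or> d = q) \<or> c = p \<and> (d = w \<or> d = q \<or> d = x)
          \<or> c = q \<and> (d = p \<or> d = w)"
      proof -
        have "c = w \<Longrightarrow> d = p \<or> d = q" "c = p \<Longrightarrow> d = w \<or> d = q \<or> d = x" "c = q \<Longrightarrow> d = p \<or> d = w"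
          using dN Nw Np Nq by simp_all
        moreover have "c = x \<or> c = p \<or> c = w \<or> c = q"
          using cd(5) by (simp add: T_def)
        ultimately show ?thesis
          by blast
      qed
      then have "x \<in> e \<or> w \<in> e \<and> p \<in> e \<or> q \<in> e \<and> p \<in> e \<or> w \<in> e \<and> q \<in> e"
        using ce by blast
      then show "e \<inter> C \<noteq> {}"
        using wq nwq by (cases "{w, q} \<in> M") (auto simp: C_def)
    qed
    then have "wt (V - insert x T) \<le> (2 / 3) ^ card (insert x T) * (9 / 8) ^ 2 * wt V"
      using TV xV by (intro wt_delete V) auto
    then show ?thesis
      using TV by (simp add: power_divide)
  qed
  have sub: "V - T \<subset> V" "V - insert x T \<subset> V"
    using pwq(1) by (auto simp: T_def)
  have b1: "real (num_mis (V - T)) \<le> wt (V - T)" and b2: "real (num_mis (V - insert x T)) \<le> wt (V - insert x T)"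
    using sub IH by (auto simp: wt_bounded_def)
  have "real (num_mis V) \<le> wt V"
    using le w1 w2 b1 b2 by linarith
  moreover have "decomposes block V" if "real (num_mis V) = wt V"
  proof -
    have e1: "real (num_mis (V - T)) = wt (V - T)" and e2: "real (num_mis (V - insert x T)) = wt (V - insert x T)"
      using that le w1 w2 b1 b2 by linarith+
    define W where "W = V - T"
    have W: "finite W" "decomposes block W" "x \<in> W" "W - {x} = V - insert x T"
      using V IH[OF sub(1)] e1 xV TV by (auto simp: W_def wt_bounded_def)
    obtain K where K: "x \<in> K" "closed W K" "block K"
      using W(2,3) unfolding decomposes_def by blast
    have KW: "K \<subseteq> W"
      using K(2) by (simp add: closed_def)
    have finK: "finite K"
      using KW W(1) finite_subset by blast
    have NK: "nbs W y = nbs K y" if "y \<in> K" for y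
      using K(2) that by (rule closed_nbs)
    \<comment> \<open>One of the at most three neighbours of \<open>x\<close> is \<open>p\<close>,
      which lies outside \<open>W\<close>. This rules out K_4 below.\<close>
    have deg2: "card (nbs K x) \<le> 2"
    proof -
      have "insert p (nbs K x) \<subseteq> nbs V x"
        using KW xV pwq(1) by (auto simp: W_def)
      then have "card (insert p (nbs K x)) \<le> card (nbs V x)"
        using V by (intro card_mono) auto
      moreover have "p \<notin> nbs K x"
        using KW by (auto simp: W_def T_def)
      ultimately have "Suc (card (nbs K x)) \<le> card (nbs V x)"
        using finK by simp
      then show ?thesis
        using deg[OF xV(1)] by linarith
    qed
    \<comment> \<open>Equality on W - x is incompatible with any configuration that
      \<open>strict_leaf\<close> covers.\<close>
    have noleaf: False if "r \<in> W - {x}" "nbs (W - {x}) r \<subseteq> {h}"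
        "h \<in> nbs (W - {x}) r \<Longrightarrow> \<exists>z\<in>W - {x}. adj h z \<and> z \<noteq> r" for r h
    proof -
      have "sub_bounded (W - {x})"
        using sb by (rule sub_bounded_subset) (auto simp: W_def)
      then have "real (num_mis (W - {x})) \<le> 7 / 8 * wt (W - {x})"
        using strict_leaf[of "W - {x}" r h] W(1) that by blast
      then show False
        using e2 wt_pos[of "W - {x}"] by (simp add: W(4))
    qed
    have "\<not> double_triangle K"
    proof
      assume "double_triangle K"
      then obtain r h z where r: "r \<in> K" "h \<in> K" "z \<in> K" "nbs K r = {x, h}" "h \<noteq> x" "adj h z" "z \<noteq> r" "z \<noteq> x"
        using double_triangle_vertex[OF _ K(1)] deg2 by fastforce
      have "x \<in> nbs K r"
        using r(4) by simp
      then have "r \<noteq> x"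
        using adj_irrefl by auto
      have "nbs (W - {x}) r \<subseteq> {h}"
        using NK[OF r(1)] r(4) by (auto simp: nbs_Diff)
      then show False
        using noleaf[of r h] r KW \<open>r \<noteq> x\<close> by blast
    qed
    then have Kc: "clique K" and c234: "card K = 2 \<or> card K = 3 \<or> card K = 4"
      using K(3) by (auto simp: block_def)
    have "nbs K x = K - {x}"
      using Kc K(1) by (rule nbs_clique)
    then have "card K \<noteq> 4"
      using deg2 K(1) finK by auto
    moreover have "card K \<noteq> 2"
    proof
      assume "card K = 2"
      then obtain y where y: "K = {x, y}" "y \<noteq> x"
        using card_2_cases K(1) by metis
      have "nbs W y = K - {y}"
        using NK[of y] nbs_clique[OF Kc, of y] y by simp
      then have "nbs (W - {x}) y = {}"
        using y by (auto simp: nbs_Diff)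
      \<comment> \<open>As \<open>y\<close> is isolated here, the second argument of
        \<open>noleaf\<close> is a dummy.\<close>
      then show False
        using noleaf[of y y] y KW by auto
    qed
    ultimately have "card K = 3"
      using c234 by blast
    then obtain s t where st: "K = {x, s, t}" "s \<noteq> x" "t \<noteq> x" "s \<noteq> t"
    proof -
      assume that: "\<And>s t. K = {x, s, t} \<Longrightarrow> s \<noteq> x \<Longrightarrow> t \<noteq> x \<Longrightarrow> s \<noteq> t \<Longrightarrow> thesis"
      have "card (K - {x}) = 2"
        using \<open>card K = 3\<close> K(1) finK by simp
      then obtain s t where "K - {x} = {s, t}" "s \<noteq> t"
        by (auto simp: card_2_iff)
      moreover from this have "K = {x, s, t}" "s \<noteq> x" "t \<noteq> x"
        using K(1) by auto
      ultimately show thesis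
        using that by blast
    qed
    have disj: "K \<inter> T = {}"
      using KW by (auto simp: W_def)
    have Tc: "clique {p, w, q}"
      using a by (auto simp: clique_def)
    have cross: "\<forall>u\<in>{p, w, q}. \<forall>v\<in>{x, s, t}. adj u v \<longrightarrow> u = p \<and> v = x"
    proof (intro ballI impI)
      fix u v assume uv: "u \<in> {p, w, q}" "v \<in> {x, s, t}" "adj u v"
      have v: "v \<in> V" "v \<notin> T"
        using uv(2) st(1) KW by (auto simp: W_def)
      then have "v \<in> nbs V u"
        using uv(3) by simp
      then have "u = w \<Longrightarrow> v = p \<or> v = q" "u = p \<Longrightarrow> v = w \<or> v = q \<or> v = x" "u = q \<Longrightarrow> v = p \<or> v = w"
        using Nw Nq Np by simp_all
      moreover have "v \<noteq> p" "v \<noteq> w" "v \<noteq> q"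
        using v(2) by (simp_all add: T_def)
      ultimately show "u = p \<and> v = x"
        using uv(1) by blast
    qed
    have dist: "distinct [p, w, q, x, s, t]"
      using ne pwq(4) x \<open>x \<noteq> p\<close> st disj by (auto simp: T_def)
    have "double_triangle (T \<union> K)"
      unfolding double_triangle_def
    proof (intro exI conjI)
      show "T \<union> K = {p, w, q, x, s, t}"
        by (auto simp: T_def st(1))
      show "clique {x, s, t}"
        using Kc by (simp add: st(1))
    qed (fact dist Tc xV(2) cross)+
    then have "block (T \<union> K)"
      by (simp add: block_def)
    moreover have "closed V (T \<union> K)"
    proof (rule closedI)
      show "T \<union> K \<subseteq> V"
        using TV KW by (auto simp: W_def)
      fix y assume "y \<in> T \<union> K"
      then show "nbs V y \<subseteq> T \<union> K"
      proof
        assume "y \<in> T"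
        then show ?thesis
          using Nw Nq Np K(1) by (auto simp: T_def)
      next
        assume "y \<in> K"
        then have "nbs W y \<subseteq> K"
          using NK by auto
        then show ?thesis
          by (auto simp: W_def)
      qed
    qed
    moreover have "decomposes block (W - K)"
      using K(2) W(2) linked_block by (rule decomposes_delete)
    moreover have "W - K = V - (T \<union> K)"
      by (auto simp: W_def)
    ultimately show ?thesis
      by (metis decomposes_insert)
  qed
  ultimately show ?thesis
    by (simp add: wt_bounded_def)
qed

text \<open>Once degrees at most 1 and at least 4 are settled, all degrees are 2 or 3. Then some
  edge joins a vertex of degree 3 to one of degree 2, or degree 3 spreads along edges and a cubic
  component exists, or the graph is 2-regular.\<close>

theorem num_mis_le_wt:
  assumes "finite V"
  shows "wt_bounded V"
  using assms
proof (induction V rule: finite_psubset_induct)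
  case (psubset V)
  note V = psubset.hyps
  have sb: "sub_bounded V"
    using psubset.IH by (simp add: sub_bounded_def wt_bounded_def)
  consider (empty) "V = {}"
    | (low) v where "v \<in> V" "card (nbs V v) \<le> 1"
    | (high) v where "v \<in> V" "card (nbs V v) \<ge> 4"
    | (mixed) p w where "p \<in> V" "w \<in> V" "adj p w" "card (nbs V p) = 3" "card (nbs V w) = 2"
        "\<And>v. v \<in> V \<Longrightarrow> card (nbs V v) = 2 \<or> card (nbs V v) = 3"
    | (cubic) v where "v \<in> V" "card (nbs V v) = 3"
        "\<And>x y. x \<in> V \<Longrightarrow> y \<in> V \<Longrightarrow> adj x y \<Longrightarrow> card (nbs V x) = 3 \<Longrightarrow> card (nbs V y) = 3"
    | (cycle) v where "v \<in> V" "\<And>v. v \<in> V \<Longrightarrow> card (nbs V v) = 2"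
  proof (cases "V = {} \<or> (\<exists>v\<in>V. card (nbs V v) \<le> 1 \<or> card (nbs V v) \<ge> 4)")
    case False
    then have deg: "card (nbs V v) = 2 \<or> card (nbs V v) = 3" if "v \<in> V" for v
      using that by (metis One_nat_def Suc_leI le_neq_implies_less not_le numeral_2_eq_2 numeral_3_eq_3
        eval_nat_numeral(2) less_Suc_eq_le numeral_eq_Suc pred_numeral_simps(2,3) semiring_norm(26,27,28))
    show ?thesis
    proof (cases "\<exists>v\<in>V. card (nbs V v) = 3")
      case True
      show ?thesis
      proof (cases "\<exists>p\<in>V. \<exists>w\<in>V. adj p w \<and> card (nbs V p) = 3 \<and> card (nbs V w) = 2")
        case True
        then show ?thesis
          using mixed deg by blast
      next
        case False
        then show ?thesis
          using True cubic deg by blast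
      qed
    next
      case no3: False
      then show ?thesis
        using cycle deg False by blast
    qed
  qed (use empty low high in blast)
  then show ?case
  proof cases
    case empty
    have "nu {} = 0"
      using nu_le_half[of "{}"] by simp
    then show ?thesis
      by (simp add: empty wt_bounded_def wt_def decomposes_def)
  next
    case low
    show ?thesis
    proof (cases "nbs V v = {}")
      case True
      then have "real (num_mis V) \<le> 7 / 8 * wt V"
        using strict_leaf[OF V sb low(1), of v] by simp
      then show ?thesis
        by (rule wt_bounded_strict) simp
    next
      case False
      then have "card (nbs V v) = 1"
        using low(2) V by (metis card_eq_0_iff finite_nbs le_neq_implies_less less_one)
      then obtain u where u: "nbs V v = {u}"
        by (rule card_1_singletonE)
      then have uV: "u \<in> V" "adj v u" "adj u v"
        using adj_sym by (auto simp: set_eq_iff)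
      show ?thesis
      proof (cases "\<exists>z\<in>V. adj u z \<and> z \<noteq> v")
        case True
        then have "real (num_mis V) \<le> 7 / 8 * wt V"
          using strict_leaf[OF V sb low(1), of u] u by simp
        then show ?thesis
          by (rule wt_bounded_strict) simp
      next
        case False
        show ?thesis
        proof (rule wt_bounded_clique[OF V psubset.IH])
          show "closed V {v, u}"
          proof (rule closedI)
            show "{v, u} \<subseteq> V"
              using low(1) uV by simp
            fix y assume "y \<in> {v, u}"
            then show "nbs V y \<subseteq> {v, u}"
              using u False by auto
          qed
          show "clique {v, u}"
            using uV by (simp add: clique_def)
          have "v \<noteq> u"
            using uV adj_irrefl by auto
          then show "card {v, u} = 2 \<or> card {v, u} = 3 \<or> card {v, u} = 4"
            by simp
        qed
      qed
    qed
  next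
    case high
    show ?thesis
      using strict_degree_4[OF V sb high] by (rule wt_bounded_strict) simp
  next
    case mixed
    obtain q where q: "nbs V w = {p, q}" "q \<noteq> p"
      using card_2_cases[OF mixed(5), of p] mixed(1,3) adj_sym by auto
    then have qV: "q \<in> V" "adj w q" "adj q w"
      using adj_sym by (auto simp: set_eq_iff)
    have "q \<noteq> w"
      using qV adj_irrefl by auto
    show ?thesis
    proof (cases "\<exists>z\<in>V. adj q z \<and> z \<noteq> w \<and> z \<noteq> p")
      case True
      then obtain z where "z \<in> V" "adj q z" "z \<noteq> w" "z \<noteq> p"
        by blast
      then have "real (num_mis V) \<le> 15 / 16 * wt V"
        using strict_degree_2_3[OF V sb mixed(2) q(1)] q(2) mixed(4) by simp
      then show ?thesis
        by (rule wt_bounded_strict) simp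
    next
      \<comment> \<open>The vertices \<open>w\<close> and \<open>q\<close> have no neighbours
        outside {p, w, q}, so this is a triangle attached at \<open>p\<close>.\<close>
      case False
      then have sub: "nbs V q \<subseteq> {p, w}"
        by auto
      have "p \<noteq> w"
        using mixed(3) adj_irrefl by auto
      then have "card {p, w} \<le> card (nbs V q)"
        using mixed(6)[OF qV(1)] by auto
      then have "nbs V q = {p, w}"
        using sub by (intro card_seteq) auto
      moreover have "card (nbs V y) \<le> 3" if "y \<in> V" for y
        using mixed(6)[OF that] by auto
      ultimately show ?thesis
        using wt_bounded_pendant_triangle[OF V psubset.IH _ mixed(1,2) qV(1) _ q(1) _ mixed(4)]
          \<open>q \<noteq> w\<close> by blast
    qed
  next
    case cubic
    show ?thesis
    proof (cases "\<exists>w\<in>nbs V v. \<exists>p\<in>nbs V w. p \<notin> cnbs V v")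
      case True
      then obtain w p where "w \<in> nbs V v" "p \<in> nbs V w" "p \<notin> cnbs V v"
        by blast
      then have "real (num_mis V) \<le> 63 / 64 * wt V"
        using strict_cubic[OF V sb cubic(1,2)] cubic(3) by blast
      then show ?thesis
        by (rule wt_bounded_strict) simp
    next
      \<comment> \<open>All neighbours of neighbours of \<open>v\<close> stay in N[v]; with four
        vertices of degree 3 this is a K_4 component.\<close>
      case False
      let ?K = "cnbs V v"
      have cK: "card ?K = 4"
        using card_cnbs[OF V, of v] cubic(2) by simp
      have KV: "?K \<subseteq> V"
        using cubic(1) by (rule cnbs_subset)
      have N: "nbs V x \<subseteq> ?K" if "x \<in> ?K" for x
        using that False by (cases "x = v") auto
      have NK: "nbs V x = ?K - {x}" if "x \<in> ?K" for x
      proof -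
        have "card (nbs V x) = 3"
          using that cubic by (cases "x = v") auto
        moreover have "card (?K - {x}) = 3"
          using that cK V by simp
        moreover have "nbs V x \<subseteq> ?K - {x}"
          using N[OF that] adj_irrefl by auto
        ultimately show ?thesis
          using V by (intro card_subset_eq) auto
      qed
      show ?thesis
      proof (rule wt_bounded_clique[OF V psubset.IH])
        show "closed V ?K"
          using KV N by (rule closedI)
        show "clique ?K"
          unfolding clique_def
        proof (intro ballI impI)
          fix x y assume "x \<in> ?K" "y \<in> ?K" "x \<noteq> y"
          then have "y \<in> nbs V x"
            using NK[of x] by blast
          then show "adj x y"
            by simp
        qed
        show "card ?K = 2 \<or> card ?K = 3 \<or> card ?K = 4"
          using cK by blast
      qed
    qed
  next
    case cycle
    obtain a b where ab: "nbs V v = {a, b}" "a \<noteq> b"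
      using cycle(2)[OF cycle(1)] by (auto simp: card_2_iff)
    show ?thesis
    proof (cases "adj a b")
      case False
      have "real (num_mis V) \<le> 63 / 64 * wt V"
        using V sb cycle(2,1) ab False by (rule strict_cycle)
      then show ?thesis
        by (rule wt_bounded_strict) simp
    next
      case True
      have abV: "a \<in> V" "b \<in> V" "adj v a" "adj a v" "adj v b" "adj b v" "adj b a"
        using ab True adj_sym by (auto simp: set_eq_iff)
      have ne: "a \<noteq> v" "b \<noteq> v"
        using abV adj_irrefl by auto
      obtain c where "nbs V a = {v, c}"
        using card_2_cases[OF cycle(2)[OF abV(1)], of v] abV cycle(1) by auto
      then have Na: "nbs V a = {v, b}"
        using abV True ne by (metis in_nbs insertE insertI1 insertI2 singletonD)
      obtain d where "nbs V b = {v, d}"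
        using card_2_cases[OF cycle(2)[OF abV(2)], of v] abV cycle(1) by auto
      then have Nb: "nbs V b = {v, a}"
        using abV True ne by (metis in_nbs insertE insertI1 insertI2 singletonD)
      show ?thesis
      proof (rule wt_bounded_clique[OF V psubset.IH])
        show "closed V {v, a, b}"
        proof (rule closedI)
          show "{v, a, b} \<subseteq> V"
            using cycle(1) abV by simp
          fix y assume "y \<in> {v, a, b}"
          then show "nbs V y \<subseteq> {v, a, b}"
            using ab Na Nb by auto
        qed
        show "clique {v, a, b}"
          using abV True by (simp add: clique_def)
        show "card {v, a, b} = 2 \<or> card {v, a, b} = 3 \<or> card {v, a, b} = 4"
          using ab(2) ne by simp
      qed
    qed
  qed
qed

section \<open>Sharpness, and recognition of the blocks\<close>

text \<open>A lower bound on the matching number is an upper bound on the weight. It evaluates to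
  card K for the cliques and to (3/2)^6 (8/9)^3 = 8 for D_6, in each case no more than the number of
  sets exhibited.\<close>

lemma block_wt_le:
  assumes "finite V" "decomposes block V"
  shows "wt V \<le> real (num_mis V)"
  using assms
proof (induction V rule: decomposes_induct)
  case (linked K)
  then show ?case
    by (rule linked_block)
next
  case empty
  have "nu {} = 0"
    using nu_le_half[of "{}"] by simp
  then show ?case
    by (simp add: wt_def)
next
  case (insert V K)
  have K: "K \<subseteq> V"
    using insert.hyps by (simp add: closed_def)
  have fin: "finite K"
    using K insert.hyps(1) finite_subset by blast
  have "wt K \<le> real (num_mis K)"
  proof (cases "double_triangle K")
    case True
    then have "card K = 6"
    proof (rule double_triangleE)
      fix p w q x s t assume "distinct [p, w, q, x, s, t]" "K = {p, w, q, x, s, t}"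
      then show ?thesis
        using distinct_card[of "[p, w, q, x, s, t]"] by simp
    qed
    moreover have "(8 / 9 :: real) ^ nu K \<le> (8 / 9) ^ 3"
      using nu_double_triangle[OF True] by (intro power_decreasing) auto
    ultimately have "wt K \<le> (3 / 2) ^ 6 * (8 / 9) ^ 3"
      unfolding wt_def by simp
    also have "\<dots> = (8 :: real)"
      by (simp add: power_divide)
    finally show ?thesis
      using num_mis_double_triangle[OF True] by linarith
  next
    case False
    then have c: "clique K" "card K = 2 \<or> card K = 3 \<or> card K = 4"
      using insert.hyps(3) by (auto simp: block_def)
    have "(8 / 9 :: real) ^ nu K \<le> (8 / 9) ^ (card K div 2)"
      using nu_clique[OF fin c(1)] by (intro power_decreasing) auto
    then have "wt K \<le> (3 / 2) ^ card K * (8 / 9) ^ (card K div 2)"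
      unfolding wt_def by (intro mult_left_mono) auto
    also have "\<dots> = card K"
      using c(2) by (auto simp: power_divide)
    finally show ?thesis
      using num_mis_clique[OF fin c(1)] by linarith
  qed
  then have "wt K * wt (V - K) \<le> real (num_mis K) * real (num_mis (V - K))"
    using insert.IH wt_pos[of "V - K"] by (intro mult_mono) auto
  moreover have "card V = card K + card (V - K)"
    using K insert.hyps(1) fin by (simp add: card_Diff_subset card_mono)
  then have "wt V = wt K * wt (V - K)"
    using nu_closed[OF insert.hyps(1,2)] by (simp add: wt_def power_add)
  moreover have "real (num_mis K) * real (num_mis (V - K)) \<le> real (num_mis V)"
    using num_mis_closed_ge[OF insert.hyps(1,2)] by (metis of_nat_le_iff of_nat_mult)
  ultimately show ?case
    by linarith
qed

lemma linked_subset_closed: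
  assumes "linked A" "closed V B" "A \<subseteq> V" "A \<inter> B \<noteq> {}"
  shows "A \<subseteq> B"
proof (rule ccontr)
  assume "\<not> A \<subseteq> B"
  then obtain x y where "x \<in> A \<inter> B" "y \<in> A - A \<inter> B" "adj x y"
    using assms(1,4) unfolding linked_def by (metis Int_lower1 inf.absorb_iff1)
  then show False
    using assms(2,3) unfolding closed_def by blast
qed

text \<open>The vertices p, w, q, x, s, t receive the labels 0 to 5, so that the joining edge
  \<open>px\<close> becomes the edge from 0 to 3.\<close>

lemma double_triangle_iff_D6:
  "double_triangle K \<longleftrightarrow> (\<exists>h. inj_on h K \<and> h ` K = {0..<6::nat} \<and>
     (\<forall>u\<in>K. \<forall>v\<in>K. adj u v \<longleftrightarrow> (h u, h v) \<in> D6_half \<union> D6_half\<inverse>))" (is "?L \<longleftrightarrow> ?R")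
proof
  assume ?L
  then show ?R
  proof (rule double_triangleE)
    fix p w q x s t
    assume d: "distinct [p, w, q, x, s, t]" and K: "K = {p, w, q, x, s, t}"
      and c: "clique {p, w, q}" "clique {x, s, t}" and px: "adj p x"
      and no: "\<forall>a\<in>{p, w, q}. \<forall>b\<in>{x, s, t}. adj a b \<longrightarrow> a = p \<and> b = x"
    define h :: "'a \<Rightarrow> nat" where "h v = (if v = p then 0 else if v = w then 1 else if v = q then 2
      else if v = x then 3 else if v = s then 4 else 5)" for v
    have h: "h p = 0" "h w = 1" "h q = 2" "h x = 3" "h s = 4" "h t = 5"
      using d by (auto simp: h_def)
    have ne: "p \<noteq> w" "p \<noteq> q" "w \<noteq> q" "x \<noteq> s" "x \<noteq> t" "s \<noteq> t"
      using d by auto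
    have pos: "adj p w" "adj w p" "adj p q" "adj q p" "adj w q" "adj q w"
      "adj x s" "adj s x" "adj x t" "adj t x" "adj s t" "adj t s" "adj p x" "adj x p"
      using c ne px adj_sym by (simp_all add: clique_def)
    have neg: "\<not> adj p s" "\<not> adj p t" "\<not> adj w x" "\<not> adj w s" "\<not> adj w t" "\<not> adj q x" "\<not> adj q s" "\<not> adj q t"
      using no ne by simp_all
    then have neg': "\<not> adj s p" "\<not> adj t p" "\<not> adj x w" "\<not> adj s w" "\<not> adj t w" "\<not> adj x q" "\<not> adj s q" "\<not> adj t q"
      using adj_sym by blast+
    have "h ` K = {0, 1, 2, 3, 4, 5}"
      by (simp add: K h)
    also have "\<dots> = {0..<6}"
      by auto
    finally have im: "h ` K = {0..<6}" .
    have "card K = 6"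
      using distinct_card[OF d] K by simp
    then have "inj_on h K"
      using im by (intro eq_card_imp_inj_on) (auto simp: K)
    moreover have "\<forall>u\<in>K. \<forall>v\<in>K. adj u v \<longleftrightarrow> (h u, h v) \<in> D6_half \<union> D6_half\<inverse>"
      unfolding K by (simp add: h pos neg neg' adj_irrefl D6_half_def)
    ultimately show ?R
      using im by blast
  qed
next
  assume ?R
  then obtain h where inj: "inj_on h K" and im: "h ` K = {0..<6::nat}"
    and adj: "\<And>u v. u \<in> K \<Longrightarrow> v \<in> K \<Longrightarrow> adj u v \<longleftrightarrow> (h u, h v) \<in> D6_half \<union> D6_half\<inverse>"
    by blast
  define g where "g = inv_into K h"
  have hg: "h (g i) = i" "g i \<in> K" if "i < 6" for i
    using that im by (auto simp: g_def f_inv_into_f inv_into_into)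
  have "K = g ` h ` K"
    using inj by (auto simp: g_def image_iff inv_into_f_f)
  also have "h ` K = {0, 1, 2, 3, 4, 5}"
    unfolding im by auto
  finally have K: "K = {g 0, g 1, g 2, g 3, g 4, g 5}"
    by simp
  have ga: "adj (g i) (g j) \<longleftrightarrow> (i, j) \<in> D6_half \<union> D6_half\<inverse>" if "i < 6" "j < 6" for i j
    using adj[of "g i" "g j"] hg that by simp
  have gi: "g i = g j \<longleftrightarrow> i = j" if "i < 6" "j < 6" for i j
    using hg(1)[OF that(1)] hg(1)[OF that(2)] by metis
  show ?L
    unfolding double_triangle_def
  proof (intro exI conjI)
    show "K = {g 0, g 1, g 2, g 3, g 4, g 5}"
      by (fact K)
  qed (simp_all add: gi ga clique_def D6_half_def)
qed

end

subsection \<open>Transfer to the given graph\<close>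

lemma (in wf_digraph) strongly_connected_imp_connected:
  "strongly_connected G \<Longrightarrow> connected G"
  by (rule connectedI) (auto simp: strongly_connected_def reachable_mk_symmetricI)

text \<open>Connectedness survives adding arcs on the same vertices, hence maximal connected
  subgraphs are induced.\<close>

lemma arc_mono_connected: "arc_mono connected"
  unfolding arc_mono_def
proof (intro allI impI, elim conjE)
  fix H1 H2 :: "('a, 'b) pre_digraph"
  assume H: "connected H1" "subgraph H1 H2" "verts H1 = verts H2"
  then interpret wf_digraph H2
    by (auto simp: subgraph_def)
  show "connected H2"
    using H by (intro connected_spanning_imp_connected[of H1]) (auto simp: spanning_def)
qed

text \<open>This opens the theory of strongly connected components. The two notions of connectedness
  agree on induced subgraphs of a symmetric digraph, but an arbitrary subgraph may contain only one
  arc of an opposite pair.\<close>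

lemma components_eq_sccs:
  assumes "graph G"
  shows "components G = pre_digraph.sccs G"
proof -
  interpret graph G
    by (fact assms)
  have sc: "strongly_connected H" if "connected H" "induced_subgraph H G" for H
  proof -
    interpret H: sym_digraph H
      using that(2) by (rule induced_graph_imp_graph)
    show ?thesis
      using H.sym_arcs that(1) by (rule H.symmetric_connected_imp_strongly_connected)
  qed
  have con: "connected H" if "strongly_connected H" "subgraph H G" for H
  proof -
    interpret H: wf_digraph H
      using that(2) by (auto simp: subgraph_def)
    show ?thesis
      using that(1) by (rule H.strongly_connected_imp_connected)
  qed
  have "max_subgraph connected H \<longleftrightarrow> max_subgraph strongly_connected H" for H
  proof
    assume H: "max_subgraph connected H"
    then have "induced_subgraph H G"
      using arc_mono_connected by (rule induced_subgraphI_arc_mono)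
    then have "strongly_connected H"
      using sc max_subgraph_prop[OF H] by blast
    then show "max_subgraph strongly_connected H"
      using H con unfolding max_subgraph_def by blast
  next
    assume H: "max_subgraph strongly_connected H"
    have sub: "subgraph H G"
      using H by (rule subgraphI_max_subgraph)
    have "\<not> connected H'" if H': "H' \<noteq> H" "subgraph H H'" "subgraph H' G" for H'
    proof
      assume "connected H'"
      \<comment> \<open>Passing to the induced subgraph restores symmetry, so the connected
        \<open>H'\<close> is enclosed in a strongly connected \<open>X\<close>, against the
        maximality of \<open>H\<close>.\<close>
      define X where "X = G \<restriction> verts H'"
      have ind: "induced_subgraph X G"
        unfolding X_def using H'(3) by (intro induced_induce) (auto simp: subgraph_def)
      have HX: "subgraph H' X"
        unfolding X_def using H'(3) by (rule subgraph_induce_subgraphI2)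
      have "connected X"
        using arc_mono_connected \<open>connected H'\<close> HX unfolding arc_mono_def
        by (metis X_def induce_subgraph_verts)
      then have "strongly_connected X"
        using ind by (rule sc)
      moreover have "subgraph H X"
        using H'(2) HX by (rule subgraph_trans)
      moreover have "subgraph X G"
        using ind by (rule induced_imp_subgraph)
      ultimately have "X = H"
        using H unfolding max_subgraph_def by blast
      then have "H' = H"
        using H'(2) HX by (auto simp: subgraph_def compatible_def intro!: pre_digraph.equality)
      then show False
        using H'(1) by contradiction
    qed
    then show "max_subgraph connected H"
      using H sub con by (auto simp: max_subgraph_def)
  qed
  then show ?thesis
    by (simp add: components_def sccs_altdef2)
qed

locale finite_simple_graph = graph G for G :: "('a, 'b) pre_digraph"
begin

sublocale adjacency "\<lambda>u v. u \<rightarrow>\<^bsub>G\<^esub> v"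
proof
  show "u \<rightarrow>\<^bsub>G\<^esub> v \<Longrightarrow> v \<rightarrow>\<^bsub>G\<^esub> u" for u v
    by (rule graph_symmetric)
  show "\<not> u \<rightarrow>\<^bsub>G\<^esub> u" for u
    using adj_not_same by blast
qed

lemma maximal_independent_set_iff: "maximal_independent_set G S \<longleftrightarrow> is_mis (verts G) S"
proof
  assume S: "maximal_independent_set G S"
  then have ind: "S \<subseteq> verts G" "\<forall>u\<in>S. \<forall>v\<in>S. \<not> u \<rightarrow>\<^bsub>G\<^esub> v"
    by (auto simp: maximal_independent_set_def independent_set_def)
  have "\<exists>y\<in>S. x \<rightarrow>\<^bsub>G\<^esub> y" if x: "x \<in> verts G - S" for x
  proof (rule ccontr)
    assume "\<not> ?thesis"
    then have "independent_set G (insert x S)"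
      using ind x adj_sym adj_irrefl unfolding independent_set_def by blast
    then have "insert x S = S"
      using S unfolding maximal_independent_set_def by blast
    then show False
      using x by blast
  qed
  then show "is_mis (verts G) S"
    using ind by (simp add: is_mis_def)
next
  assume S: "is_mis (verts G) S"
  have "T = S" if T: "independent_set G T" "S \<subseteq> T" for T
  proof (rule ccontr)
    assume "T \<noteq> S"
    then obtain x where x: "x \<in> T" "x \<notin> S"
      using T(2) by blast
    then have "x \<in> verts G - S"
      using T(1) by (auto simp: independent_set_def)
    then obtain y where "y \<in> S" "x \<rightarrow>\<^bsub>G\<^esub> y"
      using S unfolding is_mis_def by blast
    then show False
      using T x(1) unfolding independent_set_def by blast
  qed
  then show "maximal_independent_set G S"
    using S by (auto simp: maximal_independent_set_def independent_set_def is_mis_def)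
qed

lemma mis_eq: "mis G = num_mis (verts G)"
  by (simp add: mis_def num_mis_def maximal_independent_set_iff)

lemma matching_iff: "matching G M \<longleftrightarrow> is_matching (verts G) M"
proof -
  have "edge_set G = {e. \<exists>x\<in>verts G. \<exists>y\<in>verts G. x \<rightarrow>\<^bsub>G\<^esub> y \<and> e = {x, y}}"
    unfolding edge_set_def using adj_in_verts by blast
  then show ?thesis
    by (auto simp: matching_def is_matching_def)
qed

lemma matching_number_eq: "matching_number G = nu (verts G)"
  by (simp add: matching_number_def nu_def matching_iff)

lemma component_induced:
  assumes "H \<in> components G"
  shows "induced_subgraph H G"
  using assms components_eq_sccs[OF graph_axioms] in_sccs_imp_induced by blast

lemma component_subset: "H \<in> components G \<Longrightarrow> verts H \<subseteq> verts G"
  using component_induced by (auto simp: induced_subgraph_def subgraph_def)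

lemma component_adj:
  assumes "H \<in> components G"
  shows "u \<rightarrow>\<^bsub>H\<^esub> v \<longleftrightarrow> u \<in> verts H \<and> v \<in> verts H \<and> u \<rightarrow>\<^bsub>G\<^esub> v"
proof -
  have "tail H = tail G" "head H = head G" "arcs H = {e \<in> arcs G. tail G e \<in> verts H \<and> head G e \<in> verts H}"
    using component_induced[OF assms] by (auto simp: induced_subgraph_def subgraph_def compatible_def)
  then show ?thesis
    by (auto simp: arcs_ends_conv)
qed

lemma component_graph:
  assumes "H \<in> components G"
  shows "graph H"
proof -
  have ind: "induced_subgraph H G"
    using assms by (rule component_induced)
  interpret H: digraph H
    using ind by (rule digraphI_induced)
  interpret H: sym_digraph H
    using ind by (rule induced_graph_imp_graph)
  show ?thesis
    by unfold_locales
qed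

text \<open>By symmetry the ends of an arc reach each other, so they lie in the same strongly
  connected component.\<close>

lemma component_closed:
  assumes "H \<in> components G"
  shows "closed (verts G) (verts H)"
proof -
  have "verts H \<in> sccs_verts"
    using assms components_eq_sccs[OF graph_axioms] by (simp add: sccs_verts_conv)
  then have "\<not> u \<rightarrow>\<^sup>*\<^bsub>G\<^esub> v \<or> \<not> v \<rightarrow>\<^sup>*\<^bsub>G\<^esub> u" if "u \<in> verts H" "v \<notin> verts H" for u v
    using that by (simp add: in_sccs_verts_conv_reachable)
  then have "\<not> u \<rightarrow>\<^bsub>G\<^esub> v" if "u \<in> verts H" "v \<notin> verts H" for u v
    using that adj_sym reachable_adjI by blast
  then show ?thesis
    using component_subset[OF assms] by (auto simp: closed_def)
qed

lemma component_strongly_connected: "H \<in> components G \<Longrightarrow> strongly_connected H"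
  using components_eq_sccs[OF graph_axioms] by (auto simp: sccs_def)

lemma component_linked:
  assumes "H \<in> components G"
  shows "linked (verts H)"
  unfolding linked_def
proof (intro allI impI)
  fix X assume X: "X \<subseteq> verts H" "X \<noteq> {}" "X \<noteq> verts H"
  then obtain x y where xy: "x \<in> X" "y \<in> verts H" "y \<notin> X"
    by blast
  interpret H: graph H
    using assms by (rule component_graph)
  show "\<exists>x\<in>X. \<exists>y\<in>verts H - X. x \<rightarrow>\<^bsub>G\<^esub> y"
  proof (rule ccontr)
    assume no: "\<not> ?thesis"
    have "x \<rightarrow>\<^sup>*\<^bsub>H\<^esub> y"
      using component_strongly_connected[OF assms] xy X(1) by (auto simp: strongly_connected_def)
    then have "y \<in> X"
    proof (induction rule: H.reachable_induct)
      case base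
      show ?case by (fact xy(1))
    next
      case (step y z)
      then show ?case
        using no by (auto simp: component_adj[OF assms])
    qed
    then show False
      using xy(3) by contradiction
  qed
qed

lemma component_exists:
  assumes "v \<in> verts G"
  obtains H where "H \<in> components G" "v \<in> verts H"
proof
  show "G \<restriction> {w. v \<rightarrow>\<^sup>*\<^bsub>G\<^esub> w} \<in> components G"
    using induce_reachable_is_in_sccs[OF assms] components_eq_sccs[OF graph_axioms] by simp
  show "v \<in> verts (G \<restriction> {w. v \<rightarrow>\<^sup>*\<^bsub>G\<^esub> w})"
    using assms by simp
qed

text \<open>A component and a block with a common vertex are both closed and linked, so each
  contains the other.\<close>

lemma components_decomposes_iff:
  assumes "\<And>K. F K \<Longrightarrow> linked K"
  shows "(\<forall>H\<in>components G. F (verts H)) \<longleftrightarrow> decomposes F (verts G)"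
proof
  assume "\<forall>H\<in>components G. F (verts H)"
  then show "decomposes F (verts G)"
    unfolding decomposes_def by (metis component_exists component_closed)
next
  assume dec: "decomposes F (verts G)"
  show "\<forall>H\<in>components G. F (verts H)"
  proof
    fix H assume H: "H \<in> components G"
    obtain v where v: "v \<in> verts H"
      using component_strongly_connected[OF H] by (auto simp: strongly_connected_def)
    then obtain K where K: "v \<in> K" "closed (verts G) K" "F K"
      using dec component_subset[OF H] unfolding decomposes_def by blast
    have "verts H \<subseteq> K"
      using component_linked[OF H] K(2) component_subset[OF H] by (rule linked_subset_closed) (use v K in blast)
    moreover have "K \<subseteq> verts G"
      using K(2) by (simp add: closed_def)
    then have "K \<subseteq> verts H"
      by (rule linked_subset_closed[OF assms[OF K(3)] component_closed[OF H]]) (use v K in blast)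
    ultimately show "F (verts H)"
      using K(3) by simp
  qed
qed

lemma component_complete_iff:
  assumes "H \<in> components G"
  shows "complete_digraph k H \<longleftrightarrow> clique (verts H) \<and> card (verts H) = k"
proof -
  have "arcs_ends H = {(u, v). (u, v) \<in> verts H \<times> verts H \<and> u \<noteq> v} \<longleftrightarrow> clique (verts H)"
    using component_adj[OF assms] adj_irrefl by (auto simp: clique_def set_eq_iff)
  then show ?thesis
    using component_graph[OF assms] by (auto simp: complete_digraph_def)
qed

text \<open>Without parallel arcs an isomorphism amounts to its vertex map: an arc must go to the
  pair of images of its ends, since the arcs of \<open>D6\<close> are pairs with \<open>fst\<close>
  and \<open>snd\<close> as tail and head.\<close>

lemma component_D6_iff:
  assumes "H \<in> components G"
  shows "digraph_iso H D6 \<longleftrightarrow> double_triangle (verts H)"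
proof -
  interpret H: graph H
    using assms by (rule component_graph)
  note adj = component_adj[OF assms]
  have D6: "verts D6 = {0..<6}" "arcs D6 = D6_half \<union> D6_half\<inverse>" "tail D6 = fst" "head D6 = snd"
    by (simp_all add: D6_def)
  have "digraph_iso H D6 \<longleftrightarrow> (\<exists>h. inj_on h (verts H) \<and> h ` verts H = {0..<6} \<and>
      (\<lambda>(u, v). (h u, h v)) ` arcs_ends H = D6_half \<union> D6_half\<inverse>)" (is "_ \<longleftrightarrow> (\<exists>h. ?P h)")
  proof
    assume "digraph_iso H D6"
    then obtain f where f: "H.digraph_isomorphism f" "D6 = app_iso f H"
      by (auto simp: digraph_iso_def)
    have "(\<lambda>(u, v). (iso_verts f u, iso_verts f v)) ` arcs_ends H = arcs D6"
    proof -
      have "(iso_verts f (tail H e), iso_verts f (head H e)) = iso_arcs f e" if "e \<in> arcs H" for e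
      proof -
        have "iso_tail f = fst" "iso_head f = snd"
          using D6(3,4) arg_cong[OF f(2), of tail] arg_cong[OF f(2), of head] by simp_all
        then show ?thesis
          using f(1) that by (simp add: H.digraph_isomorphism_def)
      qed
      moreover have "arcs D6 = iso_arcs f ` arcs H"
        using arg_cong[OF f(2), of arcs] by simp
      ultimately show ?thesis
        by (simp add: arcs_ends_conv image_image)
    qed
    moreover have "iso_verts f ` verts H = verts D6"
      using arg_cong[OF f(2), of verts] by simp
    ultimately have "?P (iso_verts f)"
      using H.digraph_isomorphism_inj_on_verts[OF f(1)] D6(1,2) by simp
    then show "\<exists>h. ?P h"
      by (rule exI[of _ "iso_verts f"])
  next
    assume "\<exists>h. ?P h"
    then obtain h where h: "?P h" ..
    define f where "f = \<lparr> iso_verts = h, iso_arcs = (\<lambda>e. (h (tail H e), h (head H e))),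
      iso_head = snd, iso_tail = fst \<rparr>"
    have "inj_on (iso_arcs f) (arcs H)"
    proof (rule inj_onI)
      fix e e' assume e: "e \<in> arcs H" "e' \<in> arcs H" "iso_arcs f e = iso_arcs f e'"
      then have "h (tail H e) = h (tail H e')" "h (head H e) = h (head H e')"
        by (simp_all add: f_def)
      then have "tail H e = tail H e'" "head H e = head H e'"
        using h e(1,2) by (meson H.wellformed inj_onD)+
      then show "e = e'"
        using H.no_multi_arcs[OF e(1,2)] by (auto simp: arc_to_ends_def)
    qed
    then have "H.digraph_isomorphism f"
      using h H.wf_digraph by (simp add: H.digraph_isomorphism_def f_def)
    moreover have "D6 = app_iso f H"
      using h D6 by (intro pre_digraph.equality) (auto simp: app_iso_def f_def arcs_ends_conv image_image)
    ultimately show "digraph_iso H D6"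
      unfolding digraph_iso_def by blast
  qed
  also have "\<dots> \<longleftrightarrow> double_triangle (verts H)"
    unfolding double_triangle_iff_D6
  proof (intro iff_exI conj_cong refl)
    fix h :: "'a \<Rightarrow> nat"
    assume inj: "inj_on h (verts H)" and im: "h ` verts H = {0..<6}"
    have D: "D6_half \<union> D6_half\<inverse> \<subseteq> h ` verts H \<times> h ` verts H"
      unfolding im by (auto simp: D6_half_def)
    show "(\<lambda>(u, v). (h u, h v)) ` arcs_ends H = D6_half \<union> D6_half\<inverse> \<longleftrightarrow>
        (\<forall>u\<in>verts H. \<forall>v\<in>verts H. u \<rightarrow>\<^bsub>G\<^esub> v \<longleftrightarrow> (h u, h v) \<in> D6_half \<union> D6_half\<inverse>)" (is "?A = ?D \<longleftrightarrow> ?B")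
    proof
      have *: "(h u, h v) \<in> ?A \<longleftrightarrow> u \<rightarrow>\<^bsub>G\<^esub> v" if uv: "u \<in> verts H" "v \<in> verts H" for u v
      proof
        assume "(h u, h v) \<in> ?A"
        then obtain u' v' where "u' \<rightarrow>\<^bsub>H\<^esub> v'" "h u = h u'" "h v = h v'"
          by auto
        then show "u \<rightarrow>\<^bsub>G\<^esub> v"
          using inj uv by (metis adj inj_onD)
      next
        assume "u \<rightarrow>\<^bsub>G\<^esub> v"
        then have "(u, v) \<in> arcs_ends H"
          using adj uv by blast
        then show "(h u, h v) \<in> ?A"
          by force
      qed
      show "?A = ?D \<Longrightarrow> ?B"
        using * by blast
      assume B: ?B
      have key: "z \<in> ?A \<longleftrightarrow> z \<in> ?D" if z: "z \<in> h ` verts H \<times> h ` verts H" for z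
      proof -
        obtain u v where uv: "u \<in> verts H" "v \<in> verts H" "z = (h u, h v)"
          using z by auto
        show ?thesis
          unfolding uv(3) using *[OF uv(1,2)] B uv(1,2) by simp
      qed
      have A: "?A \<subseteq> h ` verts H \<times> h ` verts H"
        using adj by auto
      show "?A = ?D"
      proof (rule set_eqI)
        show "z \<in> ?A \<longleftrightarrow> z \<in> ?D" for z
          using key[of z] subsetD[OF A, of z] subsetD[OF D, of z] by argo
      qed
    qed
  qed
  finally show ?thesis .
qed

end

text \<open>With a = 3m - n and b = n - 2m, both nonnegative here, n = 2a + 3b and m = a + b: these
  are the parameters of \<open>a\<close> copies of K_2 and \<open>b\<close> triangles, whose weights
  are 2 and 3.\<close>

lemma wt_formula:
  fixes m n :: nat
  assumes "n \<le> 3 * m" "2 * m \<le> n"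
  shows "(3 / 2) ^ n * (8 / 9 :: real) ^ m = real (2 ^ (3 * m - n) * 3 ^ (n - 2 * m))"
proof -
  define a b where "a = 3 * m - n" and "b = n - 2 * m"
  have "m = a + b" "n = 2 * a + 3 * b"
    using assms by (auto simp: a_def b_def)
  then have "(3 / 2) ^ n * (8 / 9 :: real) ^ m
      = ((3 / 2) ^ 2) ^ a * ((3 / 2) ^ 3) ^ b * ((8 / 9) ^ a * (8 / 9) ^ b)"
    by (simp only: power_add power_mult)
  also have "\<dots> = ((3 / 2) ^ 2 * (8 / 9)) ^ a * ((3 / 2) ^ 3 * (8 / 9)) ^ b"
    by (simp only: power_mult_distrib mult_ac)
  also have "\<dots> = 2 ^ a * 3 ^ b"
    by (simp add: power_divide)
  finally show ?thesis
    by (simp add: a_def b_def)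
qed

theorem theorem1p8:
  fixes G :: "('a, 'b) pre_digraph" and n m :: nat
  assumes "graph G"
    and "card (verts G) = n"
    and "matching_number G = m"
  shows "mis G \<le> (if real m \<le> real n / 3 then 3 ^ m else 2 ^ (3 * m - n) * 3 ^ (n - 2 * m))
    \<and> (real m \<le> real n / 3 \<longrightarrow>
        (mis G = 3 ^ m \<longleftrightarrow>
          (\<forall>H \<in> components G. complete_digraph 3 H \<or> complete_digraph 1 H)))
    \<and> (real m > real n / 3 \<longrightarrow>
        (mis G = 2 ^ (3 * m - n) * 3 ^ (n - 2 * m) \<longleftrightarrow>
          (\<forall>H \<in> components G. complete_digraph 2 H \<or> complete_digraph 3 H \<or>
            complete_digraph 4 H \<or> digraph_iso H D6)))"
proof -
  interpret finite_simple_graph G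
    using assms(1) by (simp add: finite_simple_graph_def)
  have m: "nu (verts G) = m" "2 * m \<le> n"
    using assms nu_le_half[OF finite_verts] by (simp_all add: matching_number_eq)
  have "complete_digraph 3 H \<or> complete_digraph 1 H \<longleftrightarrow> small_block (verts H)"
    if "H \<in> components G" for H
    using component_complete_iff[OF that] by (auto simp: small_block_def)
  then have small: "(\<forall>H \<in> components G. complete_digraph 3 H \<or> complete_digraph 1 H)
      \<longleftrightarrow> decomposes small_block (verts G)"
    using components_decomposes_iff[OF linked_small_block] by blast
  have "complete_digraph 2 H \<or> complete_digraph 3 H \<or> complete_digraph 4 H \<or> digraph_iso H D6
      \<longleftrightarrow> block (verts H)" if "H \<in> components G" for H
    using component_complete_iff[OF that] component_D6_iff[OF that] by (auto simp: block_def)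
  then have big: "(\<forall>H \<in> components G. complete_digraph 2 H \<or> complete_digraph 3 H \<or>
      complete_digraph 4 H \<or> digraph_iso H D6) \<longleftrightarrow> decomposes block (verts G)"
    using components_decomposes_iff[OF linked_block] by blast
  have b1: "mis G \<le> 3 ^ m" "mis G = 3 ^ m \<longleftrightarrow> decomposes small_block (verts G)"
    using num_mis_le_3_power[OF finite_verts] small_block_3_power_le[OF finite_verts]
    by (auto simp: mis_eq m(1) intro: le_antisym)
  have b2: "real (mis G) \<le> wt (verts G)" "real (mis G) = wt (verts G) \<longleftrightarrow> decomposes block (verts G)"
    using num_mis_le_wt[OF finite_verts] block_wt_le[OF finite_verts]
    by (auto simp: mis_eq wt_bounded_def intro: antisym)
  show ?thesis
  proof (cases "real m \<le> real n / 3")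
    case True
    then show ?thesis
      using b1 small by simp
  next
    case False
    then have "n \<le> 3 * m"
      by linarith
    then have "wt (verts G) = real (2 ^ (3 * m - n) * 3 ^ (n - 2 * m))"
      unfolding wt_def assms(2) m(1) using m(2) by (rule wt_formula)
    then have "mis G \<le> 2 ^ (3 * m - n) * 3 ^ (n - 2 * m)"
      "mis G = 2 ^ (3 * m - n) * 3 ^ (n - 2 * m) \<longleftrightarrow> decomposes block (verts G)"
      using b2 by (metis of_nat_le_iff, metis of_nat_eq_iff)
    then show ?thesis
      using False big by simp
  qed
qed

end
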